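(* For each sample size $n$, let $S$ be an integer-valued random variable with $S\ge 1$ a.s., and let $s=1,\dots,S$ denote strata of sizes $n_s\ge 2$ a.s. with $\sum_{s=1}^{S} n_s=n$. For each $s$, let $\{a_{ij}^s\}_{i,j=1}^{n_s}$ be $n_s^2$ real-valued random variables, let $\bm{a}_n$ denote the collection $\{a_{ij}^s: 1\le s\le S,\ 1\le i,j\le n_s\}$, and, given $\bm{a}_n$, let $\pi=(\pi_1,\dots,\pi_S)$ be uniformly distributed over the set $\mathbb{S}_n$ of stratified permutations. Suppose that: (a) $\sum_{i=1}^{n_s}a_{ij}^{s}=\sum_{j=1}^{n_s}a_{ij}^s=0$ for all $1\leq i,j\leq n_s$ and $s=1,\dots,S$, a.s.; (b) for any $\epsilon>0$, $$\frac{1}{\sigma_n^{2}}\sum_{s=1}^{S} \frac{1}{n_s}\sum_{i,j=1}^{n_s}(a_{ij}^{s})^2\,1\big(\sigma_n^{-1}|a_{ij}^s|>\epsilon\big)\to 0 \quad\text{a.s. as } n\to\infty,$$ where $\sigma_n^2= \sum_{s=1}^{S} \frac{1}{n_s-1}\sum_{i,j=1}^{n_s}(a_{ij}^{s})^2$, and $a_{ij}^s\neq 0$ for some $(i,j)$ and $s$. Let $T^\pi= \sigma_n^{-1}\sum_{s=1}^{S} \sum_{i=1}^{n_s} a^{s}_{i\pi_s(i)}$. Then, as $n\to\infty$, $$P^\pi(T^\pi\leq t)\to \Phi(t)\ \text{ a.s., for any } t\in\mathbb{R}.$$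
   Context: All quantities ($S$, the $n_s$, the $a_{ij}^s$, $\pi$) may depend on $n$; this dependence is suppressed in the notation. In particular the distributions of $S$ and $\{a_{ij}^s\}$ may depend on $n$, and no restriction is placed on the number or sizes of strata other than $n_s\ge 2$. For a given $n$, $\mathbb{S}_n$ is the set of all stratified permutations $\pi=(\pi_1,\dots,\pi_S)$, where $\pi_s$ is a permutation of $\{1,\dots,n_s\}$ for each $s=1,\dots,S$; thus $|\mathbb{S}_n|=\prod_{s=1}^S n_s!$. Conditionally on $\bm{a}_n$ (which is understood to include the stratification $S,n_1,\dots,n_S$), $\pi$ is uniformly distributed on the finite set $\mathbb{S}_n$, and $P^\pi$ denotes the probability measure of $\pi$ conditional on $\bm{a}_n$. $1(\cdot)$ is the indicator function, $\sum_{i,j=1}^{n_s}=\sum_{i=1}^{n_s}\sum_{j=1}^{n_s}$, $\sigma_n=\sqrt{\sigma_n^2}$, and $\Phi$ is the standard normal cumulative distribution function. The almost sure statements are with respect to the randomness of the arrays $\bm{a}_n$, $n\ge1$. *)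

theory Defs
  imports "HOL-Probability.Probability" "HOL-Combinatorics.Permutations"
begin

text \<open>
  A (deterministic) stratified array consists of a number of strata \<open>S\<close>, stratum sizes \<open>N s\<close>
  and entries \<open>a s i j\<close>, meaningful for \<open>s \<in> {1..S}\<close> and \<open>i, j \<in> {1..N s}\<close> only;
  values of \<open>N\<close> and \<open>a\<close> at other indices are irrelevant to every notion below.
\<close>

text \<open>
  Outside \<open>{1..S}\<close> the value \<open>id\<close> is prescribed (as \<open>permutes\<close> does outside
  \<open>{1..N s}\<close>), so that each stratified permutation is represented by exactly one function.
\<close>

definition strat_perms :: "nat \<Rightarrow> (nat \<Rightarrow> nat) \<Rightarrow> (nat \<Rightarrow> nat \<Rightarrow> nat) set" where
  "strat_perms S N =
     {p. (\<forall>s\<in>{1..S}. p s permutes {1..N s}) \<and> (\<forall>s. s \<notin> {1..S} \<longrightarrow> p s = id)}"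

definition strat_sigma :: "nat \<Rightarrow> (nat \<Rightarrow> nat) \<Rightarrow> (nat \<Rightarrow> nat \<Rightarrow> nat \<Rightarrow> real) \<Rightarrow> real" where
  "strat_sigma S N a =
     sqrt (\<Sum>s=1..S. 1 / (real (N s) - 1) * (\<Sum>i=1..N s. \<Sum>j=1..N s. (a s i j)\<^sup>2))"

definition strat_lindeberg ::
    "nat \<Rightarrow> (nat \<Rightarrow> nat) \<Rightarrow> (nat \<Rightarrow> nat \<Rightarrow> nat \<Rightarrow> real) \<Rightarrow> real \<Rightarrow> real" where
  "strat_lindeberg S N a \<epsilon> =
     1 / (strat_sigma S N a)\<^sup>2 *
       (\<Sum>s=1..S. 1 / real (N s) *
          (\<Sum>i=1..N s. \<Sum>j=1..N s.
             (a s i j)\<^sup>2 * of_bool (inverse (strat_sigma S N a) * \<bar>a s i j\<bar> > \<epsilon>)))"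

definition strat_stat ::
    "nat \<Rightarrow> (nat \<Rightarrow> nat) \<Rightarrow> (nat \<Rightarrow> nat \<Rightarrow> nat \<Rightarrow> real) \<Rightarrow> (nat \<Rightarrow> nat \<Rightarrow> nat) \<Rightarrow> real" where
  "strat_stat S N a p =
     inverse (strat_sigma S N a) * (\<Sum>s=1..S. \<Sum>i=1..N s. a s i (p s i))"

text \<open>
  The sigma-algebra generated by a random stratified array, including the stratification.
  Values at irrelevant indices are replaced by 0 so that they carry no information.
\<close>

definition strat_data ::
    "nat \<Rightarrow> (nat \<Rightarrow> nat) \<Rightarrow> (nat \<Rightarrow> nat \<Rightarrow> nat \<Rightarrow> real) \<Rightarrow>
      nat \<times> (nat \<Rightarrow> nat) \<times> (nat \<times> nat \<times> nat \<Rightarrow> real)" where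
  "strat_data S N a =
     (S,
      (\<lambda>s. if s \<in> {1..S} then N s else 0),
      (\<lambda>(s, i, j). if s \<in> {1..S} \<and> i \<in> {1..N s} \<and> j \<in> {1..N s} then a s i j else 0))"

definition strat_algebra ::
    "'w measure \<Rightarrow> ('w \<Rightarrow> nat) \<Rightarrow> ('w \<Rightarrow> nat \<Rightarrow> nat) \<Rightarrow> ('w \<Rightarrow> nat \<Rightarrow> nat \<Rightarrow> nat \<Rightarrow> real) \<Rightarrow>
      'w measure" where
  "strat_algebra M S N a =
     vimage_algebra (space M) (\<lambda>\<omega>. strat_data (S \<omega>) (N \<omega>) (a \<omega>))
       (count_space UNIV \<Otimes>\<^sub>M (\<Pi>\<^sub>M s\<in>UNIV. count_space UNIV) \<Otimes>\<^sub>M (\<Pi>\<^sub>M k\<in>UNIV. borel))"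

text \<open>
  Conditional probability of an event given a sub-sigma-algebra: a version, determined up to
  null sets.
\<close>

definition cond_prob_alg :: "'w measure \<Rightarrow> 'w measure \<Rightarrow> ('w \<Rightarrow> bool) \<Rightarrow> 'w \<Rightarrow> real" where
  "cond_prob_alg M F P = real_cond_exp M F (indicator {\<omega> \<in> space M. P \<omega>})"

lemma card_strat_perms: "card (strat_perms S N) = (\<Prod>s=1..S. fact (N s))"
proof -
  let ?P = "PiE {1..S} (\<lambda>s. {q. q permutes {1..N s}})"
  have "bij_betw (\<lambda>p. restrict p {1..S}) (strat_perms S N) ?P"
    by (rule bij_betw_byWitness[where f' = "\<lambda>f s. if s \<in> {1..S} then f s else id"])
       (auto simp: strat_perms_def fun_eq_iff restrict_def PiE_def extensional_def)
  then have "card (strat_perms S N) = card ?P"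
    by (rule bij_betw_same_card)
  also have "\<dots> = (\<Prod>s=1..S. fact (N s))"
    by (simp add: card_PiE card_permutations)
  finally show ?thesis .
qed

lemma finite_strat_perms: "finite (strat_perms S N)"
  by (rule card_ge_0_finite) (simp add: card_strat_perms prod_pos)

lemma strat_perms_nonempty: "strat_perms S N \<noteq> {}"
  by (auto simp: strat_perms_def intro!: exI[of _ "\<lambda>_. id"] permutes_id)

text \<open>Real-valued conditional expectations in the library are only meaningful for sub-sigma-algebras.\<close>

lemma subalgebra_strat_algebra:
  assumes [measurable]: "S \<in> M \<rightarrow>\<^sub>M count_space UNIV"
    "\<And>s. (\<lambda>\<omega>. N \<omega> s) \<in> M \<rightarrow>\<^sub>M count_space UNIV"
    "\<And>s i j. (\<lambda>\<omega>. a \<omega> s i j) \<in> borel_measurable M"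
  shows "subalgebra M (strat_algebra M S N a)"
proof -
  have [measurable]: "(\<lambda>\<omega> s. if s \<in> {1..S \<omega>} then N \<omega> s else 0) \<in>
      M \<rightarrow>\<^sub>M (\<Pi>\<^sub>M s\<in>UNIV. count_space UNIV)"
    by (rule measurable_PiM_single') (auto simp: space_PiM)
  have [measurable]: "(\<lambda>\<omega> k. case k of (s, i, j) \<Rightarrow>
      if s \<in> {1..S \<omega>} \<and> i \<in> {1..N \<omega> s} \<and> j \<in> {1..N \<omega> s} then a \<omega> s i j else 0) \<in>
      M \<rightarrow>\<^sub>M (\<Pi>\<^sub>M k\<in>UNIV. borel)"
    by (rule measurable_PiM_single') (auto simp: space_PiM split_beta')
  have "(\<lambda>\<omega>. strat_data (S \<omega>) (N \<omega>) (a \<omega>)) \<in>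
    M \<rightarrow>\<^sub>M (count_space UNIV \<Otimes>\<^sub>M (\<Pi>\<^sub>M s\<in>UNIV. count_space UNIV) \<Otimes>\<^sub>M (\<Pi>\<^sub>M k\<in>UNIV. borel))"
    unfolding strat_data_def by measurable
  note meas = measurable_sets[OF this]
  show ?thesis
    unfolding subalgebra_def strat_algebra_def
    by (auto simp: sets_vimage_algebra2 space_pair_measure space_PiM meas)
qed

end

theory Submission
  imports Defs
begin

text \<open>
  Stein's method for the single test function \<open>x \<mapsto> cis (u * x)\<close>. Multiplying one component of the
  stratified permutation by a transposition preserves the uniform distribution, and the rows and
  columns sum to zero; three such exchanges show that the characteristic function \<open>\<phi>\<close> of the
  statistic satisfies \<open>\<phi>' u + u * \<phi> u = o(1)\<close>, whence \<open>\<phi> u \<longlonglongrightarrow> exp (- u\<^sup>2 / 2)\<close>, and Levy's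
  theorem applies. The error terms are sums of \<open>(A i j)\<^sup>2 * min 2 \<bar>u * D\<bar>\<close>, where \<open>D\<close> is the
  change of the statistic under an exchange and involves four entries. They are small without any
  truncation of the array: the Lindeberg condition bounds the proportion of large entries in every
  single row and column, and entries in different random columns are nearly independent.

  Conditionally on the array, \<open>\<pi>\<close> almost surely ranges over a finite set depending only on \<open>n\<close>, so the
  conditional probability is a finite sum and the almost sure statement is the deterministic one.
\<close>

section \<open>Taylor bounds for \<open>cis\<close>\<close>

lemma norm_cis_diff_1_le: "cmod (cis x - 1) \<le> min 2 \<bar>x\<bar>"
  using iexp_approx1[of x 0] iexp_approx2[of x 0] by (simp add: cis_conv_exp)

text \<open>Taking the smaller of the linear and the quadratic estimate leaves the factor
  \<open>min 2 \<bar>x\<bar>\<close>, the one that also bounds \<open>cis x - 1\<close>. All error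
  terms below can therefore be measured by the single kernel \<open>tr\<close>.\<close>

lemma norm_cis_taylor_1_le: "cmod (cis x - 1 - \<i> * x) \<le> \<bar>x\<bar> * min 2 \<bar>x\<bar>"
proof -
  have "cmod (cis x - 1 - \<i> * x) \<le> \<bar>x\<bar> * \<bar>x\<bar> / 2" "cmod (cis x - 1 - \<i> * x) \<le> \<bar>x\<bar> * 2"
    using iexp_approx1[of x 1] iexp_approx2[of x 1]
    by (simp_all add: cis_conv_exp power2_eq_square algebra_simps)
  moreover from this(1) have "cmod (cis x - 1 - \<i> * x) \<le> \<bar>x\<bar> * \<bar>x\<bar>"
    by (rule order.trans) simp
  ultimately show ?thesis
    by (cases "2 \<le> \<bar>x\<bar>") (simp_all add: min_def)
qed

section \<open>Exchanges within one stratum\<close>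

text \<open>
  Below, \<open>P\<close> is the set of stratified permutations, \<open>q p\<close> is the component of \<open>p\<close> in one fixed stratum,
  \<open>sw i j\<close> multiplies that component by a transposition, and \<open>T\<close> is the statistic summed over all
  strata. Only the contribution of the fixed stratum to \<open>T\<close> changes under \<open>sw i j\<close>, so independence of
  the strata is never used.
\<close>

locale swap_model =
  fixes P :: "'p set" and I :: "'i set" and q :: "'p \<Rightarrow> 'i \<Rightarrow> 'i"
    and sw :: "'i \<Rightarrow> 'i \<Rightarrow> 'p \<Rightarrow> 'p" and A :: "'i \<Rightarrow> 'i \<Rightarrow> real" and T :: "'p \<Rightarrow> real"
  assumes finite_P: "finite P" and finite_I: "finite I" and card_I: "card I \<ge> 2"
    and q_permutes: "p \<in> P \<Longrightarrow> q p permutes I"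
    and sw_in: "\<lbrakk>i \<in> I; j \<in> I; p \<in> P\<rbrakk> \<Longrightarrow> sw i j p \<in> P"
    and sw_sw: "\<lbrakk>i \<in> I; j \<in> I; p \<in> P\<rbrakk> \<Longrightarrow> sw i j (sw i j p) = p"
    and q_sw: "\<lbrakk>i \<in> I; j \<in> I; p \<in> P\<rbrakk> \<Longrightarrow> q (sw i j p) = q p \<circ> Transposition.transpose i j"
    and row_sum: "i \<in> I \<Longrightarrow> (\<Sum>j\<in>I. A i j) = 0"
    and col_sum: "j \<in> I \<Longrightarrow> (\<Sum>i\<in>I. A i j) = 0"
    and T_sw: "\<lbrakk>i \<in> I; j \<in> I; p \<in> P\<rbrakk> \<Longrightarrow>
      T (sw i j p) = T p + (A i (q p j) + A j (q p i) - A i (q p i) - A j (q p j))"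
begin

definition D :: "'i \<Rightarrow> 'i \<Rightarrow> 'p \<Rightarrow> real" where
  "D i j p = A i (q p j) + A j (q p i) - A i (q p i) - A j (q p j)"

definition S2 :: real where "S2 = (\<Sum>i\<in>I. \<Sum>j\<in>I. (A i j)\<^sup>2)"

text \<open>Invariance of the uniform distribution on \<open>P\<close>: an exchange is an involution
  of \<open>P\<close>, so it only reorders the sum.\<close>

lemma sum_sw: "\<lbrakk>i \<in> I; j \<in> I\<rbrakk> \<Longrightarrow> (\<Sum>p\<in>P. h (sw i j p)) = sum h P"
  by (rule sum.reindex_bij_witness[of _ "sw i j" "sw i j"]) (auto simp: sw_in sw_sw)

lemma q_sw_apply: "\<lbrakk>i \<in> I; j \<in> I; p \<in> P\<rbrakk> \<Longrightarrow> q (sw i j p) k = q p (Transposition.transpose i j k)"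
  by (simp add: q_sw)

lemma D_sw: "\<lbrakk>i \<in> I; j \<in> I; p \<in> P\<rbrakk> \<Longrightarrow> D i j (sw i j p) = - D i j p"
  by (simp add: D_def q_sw_apply)

lemma D_refl [simp]: "D i i p = 0"
  by (simp add: D_def)

lemma D_commute: "D i j p = D j i p"
  by (simp add: D_def)

lemma sum_q: "p \<in> P \<Longrightarrow> (\<Sum>i\<in>I. g (q p i)) = sum g I"
  using sum.permute[OF q_permutes, of p g] by (simp add: o_def)

lemma q_in: "\<lbrakk>p \<in> P; i \<in> I\<rbrakk> \<Longrightarrow> q p i \<in> I"
  using q_permutes[of p] by (simp add: permutes_in_image)

lemma row_sum_q: "\<lbrakk>p \<in> P; i \<in> I\<rbrakk> \<Longrightarrow> (\<Sum>j\<in>I. A i (q p j)) = 0"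
  by (simp add: sum_q row_sum)

lemma row_sum_q_minus: "\<lbrakk>p \<in> P; i \<in> I; a \<in> I\<rbrakk> \<Longrightarrow> (\<Sum>j\<in>I-{a}. A i (q p j)) = - A i (q p a)"
  using row_sum_q[of p i] by (simp add: sum_diff1 finite_I)

lemma col_sum_q_minus: "\<lbrakk>p \<in> P; j \<in> I; a \<in> I\<rbrakk> \<Longrightarrow> (\<Sum>i\<in>I-{a}. A i (q p j)) = - A a (q p j)"
  using col_sum[of "q p j"] by (simp add: sum_diff1 finite_I q_in)

section \<open>The Stein identity with exact remainders\<close>

definition R1 :: "complex \<Rightarrow> ('p \<Rightarrow> complex) \<Rightarrow> complex" where
  "R1 z e = (\<Sum>i\<in>I. \<Sum>a\<in>I. \<Sum>p\<in>P. complex_of_real (A i (q p a)) * (e (sw i a p) - e p - z * complex_of_real (D i a p) * e p))"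

text \<open>\<open>R2\<close> and \<open>R3\<close> collect the changes of \<open>e\<close> caused
  by the second and the third exchange, which decouple \<open>Q\<close> and \<open>V\<close>.
  \<open>R1\<close> collects the first-order Taylor remainders of the first exchange, where
  \<open>z\<close> will be \<open>\<i> * u\<close>.\<close>

definition R2 :: "('p \<Rightarrow> complex) \<Rightarrow> complex" where
  "R2 e = (\<Sum>a\<in>I. \<Sum>i\<in>I-{a}. \<Sum>b\<in>I-{a}. \<Sum>p\<in>P.
     complex_of_real (A i (q p a) * A a (q p b)) * (e (sw i b p) - e p))"

definition R3 :: "('p \<Rightarrow> complex) \<Rightarrow> complex" where
  "R3 e = (\<Sum>a\<in>I. \<Sum>b\<in>I. \<Sum>p\<in>P. complex_of_real ((A a (q p b))\<^sup>2) * (e (sw a b p) - e p))"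

definition V :: "'p \<Rightarrow> real" where "V p = (\<Sum>a\<in>I. (A a (q p a))\<^sup>2)"

text \<open>The cross term that remains when \<open>A i (q p a)\<close> is multiplied by
  \<open>D i a p\<close>; the other products are constant in total or cancel.\<close>

definition Q :: "'p \<Rightarrow> real" where "Q p = (\<Sum>i\<in>I. \<Sum>a\<in>I. A i (q p a) * A a (q p i))"

text \<open>Exchanging \<open>i\<close> and \<open>a\<close> moves the weight from
  \<open>A i (q p i)\<close> to \<open>A i (q p a)\<close>. After summation over all
  \<open>a\<close>, the term \<open>e p\<close> can be subtracted at no cost, because the row sums
  vanish.\<close>

lemma exchange:
  fixes e :: "'p \<Rightarrow> complex"
  shows "of_nat (card I) * (\<Sum>p\<in>P. complex_of_real (\<Sum>i\<in>I. A i (q p i)) * e p) =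
    (\<Sum>i\<in>I. \<Sum>a\<in>I. \<Sum>p\<in>P. complex_of_real (A i (q p a)) * (e (sw i a p) - e p))"
proof -
  have *: "of_nat (card I) * (\<Sum>p\<in>P. complex_of_real (A i (q p i)) * e p) =
     (\<Sum>a\<in>I. \<Sum>p\<in>P. complex_of_real (A i (q p a)) * (e (sw i a p) - e p))" if i: "i \<in> I" for i
  proof -
    have "(\<Sum>p\<in>P. complex_of_real (A i (q p i)) * e p) =
      (\<Sum>p\<in>P. complex_of_real (A i (q p a)) * e (sw i a p))" if a: "a \<in> I" for a
      using sum_sw[OF i a, of "\<lambda>p. complex_of_real (A i (q p i)) * e p"]
      by (simp add: q_sw_apply i a cong: sum.cong)
    then have "of_nat (card I) * (\<Sum>p\<in>P. complex_of_real (A i (q p i)) * e p) =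
      (\<Sum>a\<in>I. \<Sum>p\<in>P. complex_of_real (A i (q p a)) * e (sw i a p))"
      by (simp flip: sum_constant cong: sum.cong)
    moreover have "(\<Sum>a\<in>I. \<Sum>p\<in>P. complex_of_real (A i (q p a)) * e p) =
      (\<Sum>p\<in>P. complex_of_real (\<Sum>a\<in>I. A i (q p a)) * e p)"
      by (subst sum.swap) (simp add: sum_distrib_right)
    ultimately show ?thesis
      by (simp add: right_diff_distrib sum_subtractf row_sum_q i)
  qed
  have "of_nat (card I) * (\<Sum>p\<in>P. complex_of_real (\<Sum>i\<in>I. A i (q p i)) * e p) =
    (\<Sum>i\<in>I. of_nat (card I) * (\<Sum>p\<in>P. complex_of_real (A i (q p i)) * e p))"
    by (subst sum_distrib_left[symmetric], subst sum.swap) (simp add: sum_distrib_right)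
  then show ?thesis
    by (simp add: *)
qed

text \<open>Of the four products of \<open>A i (q p a)\<close> with the entries of
  \<open>D i a p\<close>, the square gives \<open>S2\<close>, the one with
  \<open>A a (q p i)\<close> gives \<open>Q\<close>, and the two with a minus sign vanish by the row
  and the column sums.\<close>

lemma sum_A_D:
  assumes p: "p \<in> P"
  shows "(\<Sum>i\<in>I. \<Sum>a\<in>I. A i (q p a) * D i a p) = S2 + Q p"
proof -
  have "(\<Sum>i\<in>I. \<Sum>a\<in>I. A i (q p a) * D i a p) =
      (\<Sum>i\<in>I. \<Sum>a\<in>I. (A i (q p a))\<^sup>2) + Q p - (\<Sum>i\<in>I. (\<Sum>a\<in>I. A i (q p a)) * A i (q p i))
        - (\<Sum>i\<in>I. \<Sum>a\<in>I. A i (q p a) * A a (q p a))"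
    by (simp add: D_def Q_def algebra_simps power2_eq_square sum.distrib sum_subtractf
        sum_distrib_left)
  also have "(\<Sum>i\<in>I. \<Sum>a\<in>I. A i (q p a) * A a (q p a)) =
      (\<Sum>a\<in>I. (\<Sum>i\<in>I. A i (q p a)) * A a (q p a))"
    by (subst sum.swap) (simp add: sum_distrib_right)
  also have "(\<Sum>i\<in>I. \<Sum>a\<in>I. (A i (q p a))\<^sup>2) = S2"
    unfolding S2_def by (intro sum.cong refl sum_q p)
  finally show ?thesis
    by (simp add: row_sum_q col_sum q_in p)
qed

text \<open>For \<open>i \<noteq> a\<close>, exchange \<open>i\<close> with each
  \<open>b \<noteq> a\<close>: the factor \<open>A i (q p a)\<close> stays, while
  \<open>A a (q p i)\<close> is averaged over row \<open>a\<close> without the position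
  \<open>a\<close>. The row sum and then the column sum turn the total into \<open>V\<close>. The
  diagonal of \<open>Q\<close> is \<open>V\<close> as well and enters \<open>card I - 1\<close>
  times, hence the factor \<open>card I\<close>.\<close>

lemma decouple_Q:
  fixes e :: "'p \<Rightarrow> complex"
  shows "complex_of_real (real (card I) - 1) * (\<Sum>p\<in>P. complex_of_real (Q p) * e p) = of_nat (card I) * (\<Sum>p\<in>P. complex_of_real (V p) * e p) + R2 e"
proof -
  define n1 where "n1 = complex_of_real (real (card I) - 1)"
  \<comment> \<open>\<open>n1\<close> is written as a sum over \<open>I - {a}\<close> so that
    multiplication by it becomes summation over the exchange partner \<open>b\<close>.\<close>
  have n1: "n1 = (\<Sum>b\<in>I-{a}. 1)" if "a \<in> I" for a
    using that card_I by (simp add: n1_def finite_I of_nat_diff)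
  define G where "G i a p = complex_of_real (A i (q p a) * A a (q p i))" for i a p
  have *: "n1 * (\<Sum>p\<in>P. G i a p * e p) =
      (\<Sum>p\<in>P. complex_of_real (- (A i (q p a) * A a (q p a))) * e p) +
      (\<Sum>b\<in>I-{a}. \<Sum>p\<in>P. complex_of_real (A i (q p a) * A a (q p b)) * (e (sw i b p) - e p))"
    if a: "a \<in> I" and i: "i \<in> I - {a}" for i a
  proof -
    have "(\<Sum>p\<in>P. G i a p * e p) =
        (\<Sum>p\<in>P. complex_of_real (A i (q p a) * A a (q p b)) * e (sw i b p))" if b: "b \<in> I - {a}" for b
      using sum_sw[of i b "\<lambda>p. G i a p * e p"] a i b not_sym[of i a] not_sym[of b a]
      by (simp add: q_sw_apply G_def Transposition.transpose_def cong: sum.cong)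
    then have "(\<Sum>b\<in>I-{a}. \<Sum>p\<in>P. G i a p * e p) =
        (\<Sum>b\<in>I-{a}. \<Sum>p\<in>P. complex_of_real (A i (q p a) * A a (q p b)) * e (sw i b p))"
      by (rule sum.cong[OF refl])
    then have "n1 * (\<Sum>p\<in>P. G i a p * e p) =
        (\<Sum>b\<in>I-{a}. \<Sum>p\<in>P. complex_of_real (A i (q p a) * A a (q p b)) * e (sw i b p))"
      unfolding n1[OF a] sum_distrib_right mult_1 .
    moreover have "(\<Sum>b\<in>I-{a}. \<Sum>p\<in>P. complex_of_real (A i (q p a) * A a (q p b)) * e p) =
        (\<Sum>p\<in>P. complex_of_real (A i (q p a) * (\<Sum>b\<in>I-{a}. A a (q p b))) * e p)"
      by (subst sum.swap) (simp add: sum_distrib_right sum_distrib_left)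
    moreover have "\<dots> = (\<Sum>p\<in>P. complex_of_real (- (A i (q p a) * A a (q p a))) * e p)"
      by (intro sum.cong refl) (simp add: row_sum_q_minus a)
    ultimately show ?thesis
      by (simp add: right_diff_distrib sum_subtractf)
  qed
  have Q: "complex_of_real (Q p) = (\<Sum>a\<in>I. \<Sum>i\<in>I-{a}. G i a p) + complex_of_real (V p)" for p
  proof -
    have "(\<Sum>i\<in>I. G i a p) = (\<Sum>i\<in>I-{a}. G i a p) + complex_of_real ((A a (q p a))\<^sup>2)" if "a \<in> I" for a
      using sum.remove[OF finite_I that, of "\<lambda>i. G i a p"]
      by (simp add: G_def power2_eq_square)
    then have "(\<Sum>a\<in>I. \<Sum>i\<in>I. G i a p) = (\<Sum>a\<in>I. \<Sum>i\<in>I-{a}. G i a p) + complex_of_real (V p)"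
      by (simp add: sum.distrib V_def cong: sum.cong)
    moreover have "complex_of_real (Q p) = (\<Sum>a\<in>I. \<Sum>i\<in>I. G i a p)"
      unfolding Q_def by (subst sum.swap) (simp add: G_def)
    ultimately show ?thesis
      by simp
  qed
  have "(\<Sum>p\<in>P. complex_of_real (Q p) * e p) =
      (\<Sum>p\<in>P. \<Sum>a\<in>I. \<Sum>i\<in>I-{a}. G i a p * e p) + (\<Sum>p\<in>P. complex_of_real (V p) * e p)"
    by (simp add: Q distrib_right sum.distrib sum_distrib_right)
  also have "(\<Sum>p\<in>P. \<Sum>a\<in>I. \<Sum>i\<in>I-{a}. G i a p * e p) = (\<Sum>a\<in>I. \<Sum>p\<in>P. \<Sum>i\<in>I-{a}. G i a p * e p)"
    by (rule sum.swap)
  also have "\<dots> = (\<Sum>a\<in>I. \<Sum>i\<in>I-{a}. \<Sum>p\<in>P. G i a p * e p)"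
    by (intro sum.cong refl sum.swap)
  finally have "n1 * (\<Sum>p\<in>P. complex_of_real (Q p) * e p) =
      (\<Sum>a\<in>I. \<Sum>i\<in>I-{a}. n1 * (\<Sum>p\<in>P. G i a p * e p)) + n1 * (\<Sum>p\<in>P. complex_of_real (V p) * e p)"
    by (simp only: distrib_left sum_distrib_left)
  also have "(\<Sum>a\<in>I. \<Sum>i\<in>I-{a}. n1 * (\<Sum>p\<in>P. G i a p * e p)) =
     (\<Sum>a\<in>I. \<Sum>i\<in>I-{a}. \<Sum>p\<in>P. complex_of_real (- (A i (q p a) * A a (q p a))) * e p) + R2 e"
    unfolding R2_def sum.distrib[symmetric] by (intro sum.cong refl) (rule *)
  \<comment> \<open>The row sum without \<open>a\<close> has produced one minus sign; the column sum
    without \<open>a\<close> produces a second one, so that \<open>V\<close> appears with a plus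
    sign.\<close>
  also have "(\<Sum>a\<in>I. \<Sum>i\<in>I-{a}. \<Sum>p\<in>P. complex_of_real (- (A i (q p a) * A a (q p a))) * e p) =
     (\<Sum>a\<in>I. \<Sum>p\<in>P. complex_of_real (- (\<Sum>i\<in>I-{a}. A i (q p a)) * A a (q p a)) * e p)"
    by (intro sum.cong refl, subst sum.swap) (simp add: sum_distrib_right sum_negf)
  also have "\<dots> = (\<Sum>p\<in>P. \<Sum>a\<in>I. complex_of_real (- (\<Sum>i\<in>I-{a}. A i (q p a)) * A a (q p a)) * e p)"
    by (rule sum.swap)
  also have "\<dots> = (\<Sum>p\<in>P. complex_of_real (V p) * e p)"
    by (intro sum.cong refl) (simp add: V_def col_sum_q_minus sum_distrib_right power2_eq_square)
  finally show ?thesis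
    by (simp add: n1_def algebra_simps)
qed

text \<open>Exchanging \<open>a\<close> with every \<open>b\<close> replaces the random square at
  position \<open>a\<close> by the deterministic sum of squares of row \<open>a\<close>.\<close>

lemma decouple_V:
  fixes e :: "'p \<Rightarrow> complex"
  shows "of_nat (card I) * (\<Sum>p\<in>P. complex_of_real (V p) * e p) = complex_of_real S2 * (\<Sum>p\<in>P. e p) + R3 e"
proof -
  have *: "of_nat (card I) * (\<Sum>p\<in>P. complex_of_real ((A a (q p a))\<^sup>2) * e p) =
      (\<Sum>b\<in>I. \<Sum>p\<in>P. complex_of_real ((A a (q p b))\<^sup>2) * (e (sw a b p) - e p)) +
      complex_of_real (\<Sum>b\<in>I. (A a b)\<^sup>2) * (\<Sum>p\<in>P. e p)" if a: "a \<in> I" for a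
  proof -
    have "(\<Sum>p\<in>P. complex_of_real ((A a (q p a))\<^sup>2) * e p) =
      (\<Sum>p\<in>P. complex_of_real ((A a (q p b))\<^sup>2) * e (sw a b p))" if b: "b \<in> I" for b
      using sum_sw[OF a b, of "\<lambda>p. complex_of_real ((A a (q p a))\<^sup>2) * e p"]
      by (simp add: q_sw_apply a b cong: sum.cong)
    then have "of_nat (card I) * (\<Sum>p\<in>P. complex_of_real ((A a (q p a))\<^sup>2) * e p) =
      (\<Sum>b\<in>I. \<Sum>p\<in>P. complex_of_real ((A a (q p b))\<^sup>2) * e (sw a b p))"
      by (simp flip: sum_constant cong: sum.cong)
    moreover have "(\<Sum>b\<in>I. \<Sum>p\<in>P. complex_of_real ((A a (q p b))\<^sup>2) * e p) =
      (\<Sum>p\<in>P. complex_of_real (\<Sum>b\<in>I. (A a (q p b))\<^sup>2) * e p)"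
      by (subst sum.swap) (simp add: sum_distrib_right)
    moreover have "\<dots> = complex_of_real (\<Sum>b\<in>I. (A a b)\<^sup>2) * (\<Sum>p\<in>P. e p)"
      unfolding sum_distrib_left by (intro sum.cong refl) (subst sum_q, auto)
    ultimately show ?thesis
      by (simp add: right_diff_distrib sum_subtractf)
  qed
  have "of_nat (card I) * (\<Sum>p\<in>P. complex_of_real (V p) * e p) =
    (\<Sum>a\<in>I. of_nat (card I) * (\<Sum>p\<in>P. complex_of_real ((A a (q p a))\<^sup>2) * e p))"
    unfolding V_def
    by (subst sum_distrib_left[symmetric], subst sum.swap) (simp add: sum_distrib_right)
  also have "\<dots> = complex_of_real S2 * (\<Sum>p\<in>P. e p) + R3 e"
    unfolding R3_def S2_def of_real_sum[of _ I] sum_distrib_right[of _ I] sum.distrib[symmetric]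
    by (intro sum.cong refl) (subst *, assumption, simp add: sum_distrib_right sum.distrib)
  finally show ?thesis .
qed

text \<open>The first exchange leaves \<open>S2 + Q\<close>, and \<open>(n - 1) * Q\<close> amounts
  to \<open>S2\<close> up to remainders, so \<open>S2\<close> occurs \<open>(n - 1) + 1 = n\<close>
  times. After division by \<open>n * (n - 1)\<close> its coefficient is
  \<open>S2 / (n - 1)\<close>, the share of the stratum in the variance.\<close>

lemma stein_identity:
  fixes e :: "'p \<Rightarrow> complex" and z :: complex
  defines "n \<equiv> complex_of_real (card I)"
  shows "n * (n - 1) * (\<Sum>p\<in>P. complex_of_real (\<Sum>i\<in>I. A i (q p i)) * e p) =
    z * n * complex_of_real S2 * (\<Sum>p\<in>P. e p) + (z * (R2 e + R3 e) + (n - 1) * R1 z e)"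
proof -
  have "R1 z e = n * (\<Sum>p\<in>P. complex_of_real (\<Sum>i\<in>I. A i (q p i)) * e p) -
      (\<Sum>i\<in>I. \<Sum>a\<in>I. \<Sum>p\<in>P. complex_of_real (A i (q p a)) * (z * complex_of_real (D i a p) * e p))"
    using exchange[of e] by (simp add: R1_def n_def right_diff_distrib sum_subtractf)
  also have "(\<Sum>i\<in>I. \<Sum>a\<in>I. \<Sum>p\<in>P. complex_of_real (A i (q p a)) * (z * complex_of_real (D i a p) * e p)) =
      (\<Sum>i\<in>I. \<Sum>p\<in>P. \<Sum>a\<in>I. complex_of_real (A i (q p a)) * (z * complex_of_real (D i a p) * e p))"
    by (intro sum.cong refl sum.swap)
  also have "\<dots> = (\<Sum>p\<in>P. \<Sum>i\<in>I. \<Sum>a\<in>I. complex_of_real (A i (q p a)) * (z * complex_of_real (D i a p) * e p))"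
    by (rule sum.swap)
  also have "\<dots> = (\<Sum>p\<in>P. z * complex_of_real (\<Sum>i\<in>I. \<Sum>a\<in>I. A i (q p a) * D i a p) * e p)"
    by (simp add: sum_distrib_left sum_distrib_right mult_ac)
  also have "\<dots> = (\<Sum>p\<in>P. z * complex_of_real (S2 + Q p) * e p)"
    by (simp add: sum_A_D cong: sum.cong del: of_real_sum of_real_add)
  also have "\<dots> = z * complex_of_real S2 * (\<Sum>p\<in>P. e p) + z * (\<Sum>p\<in>P. complex_of_real (Q p) * e p)"
    by (simp add: sum_distrib_left sum_distrib_right sum.distrib algebra_simps)
  finally have r1: "n * (\<Sum>p\<in>P. complex_of_real (\<Sum>i\<in>I. A i (q p i)) * e p) =
    z * complex_of_real S2 * (\<Sum>p\<in>P. e p) + z * (\<Sum>p\<in>P. complex_of_real (Q p) * e p) + R1 z e"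
    by simp
  have r2: "(n - 1) * (\<Sum>p\<in>P. complex_of_real (Q p) * e p) = complex_of_real S2 * (\<Sum>p\<in>P. e p) + R3 e + R2 e"
    using decouple_Q[of e] decouple_V[of e] by (simp add: n_def)
  from r1 r2 show ?thesis
    by algebra
qed

section \<open>One and two coordinates of a uniform permutation\<close>

lemma marginal:
  fixes g :: "'i \<Rightarrow> real"
  assumes y: "y \<in> I"
  shows "real (card I) * (\<Sum>p\<in>P. g (q p y)) = real (card P) * sum g I"
proof -
  \<comment> \<open>All positions have the same distribution, so the claim reduces to summing over
    all positions, where \<open>q p\<close> is a bijection of \<open>I\<close>.\<close>
  have "(\<Sum>p\<in>P. g (q p y)) = (\<Sum>p\<in>P. g (q p b))" if b: "b \<in> I" for b
    using sum_sw[OF y b, of "\<lambda>p. g (q p y)"] by (simp add: q_sw_apply y b cong: sum.cong)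
  then have "real (card I) * (\<Sum>p\<in>P. g (q p y)) = (\<Sum>b\<in>I. \<Sum>p\<in>P. g (q p b))"
    by (simp flip: sum_constant cong: sum.cong)
  then show ?thesis
    by (subst (asm) sum.swap) (simp add: sum_q)
qed

text \<open>Given \<open>q p y\<close>, the value \<open>q p y'\<close> is uniform on the other
  \<open>card I - 1\<close> points, so the mean of \<open>h\<close> there is at most
  \<open>card I / (card I - 1) * \<eta>\<close>. The constant 2 covers this quotient because
  \<open>card I \<ge> 2\<close>. In this sense distinct columns are nearly independent.\<close>

lemma pair_bound:
  fixes g h :: "'i \<Rightarrow> real" and \<eta> :: real
  assumes y: "y \<in> I" and y': "y' \<in> I" and ne: "y \<noteq> y'"
    and g: "\<And>k. g k \<ge> 0" and h: "\<And>k. h k \<ge> 0" and sum_h: "sum h I \<le> card I * \<eta>"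
  shows "(\<Sum>p\<in>P. g (q p y) * h (q p y')) \<le> 2 * \<eta> * (\<Sum>p\<in>P. g (q p y))"
proof -
  let ?X = "\<Sum>p\<in>P. g (q p y) * h (q p y')" and ?G = "\<Sum>p\<in>P. g (q p y)"
  have n: "real (card I) \<ge> 2" using card_I by simp
  have "?X = (\<Sum>p\<in>P. g (q p y) * h (q p b))" if b: "b \<in> I - {y}" for b
    using sum_sw[of y' b "\<lambda>p. g (q p y) * h (q p y')"] y y' ne b not_sym[of b y]
    by (simp add: q_sw_apply Transposition.transpose_def cong: sum.cong)
  then have "(\<Sum>b\<in>I-{y}. ?X) = (\<Sum>b\<in>I-{y}. \<Sum>p\<in>P. g (q p y) * h (q p b))"
    by (rule sum.cong[OF refl])
  also have "\<dots> = (\<Sum>p\<in>P. g (q p y) * (\<Sum>b\<in>I-{y}. h (q p b)))"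
    by (subst sum.swap) (simp add: sum_distrib_left)
  also have "\<dots> \<le> (\<Sum>p\<in>P. g (q p y) * (\<Sum>b\<in>I. h (q p b)))"
    by (intro sum_mono mult_left_mono g sum_mono2) (auto simp: finite_I h)
  also have "\<dots> = sum h I * ?G"
    by (simp add: sum_q sum_distrib_left mult.commute)
  also have "\<dots> \<le> card I * \<eta> * ?G"
    by (intro mult_right_mono sum_h sum_nonneg g)
  finally have "(real (card I) - 1) * ?X \<le> card I * \<eta> * ?G"
    using y n by (simp add: finite_I of_nat_diff)
  also have "\<dots> \<le> (real (card I) - 1) * (2 * \<eta> * ?G)"
  proof -
    have "card I * \<eta> \<ge> 0"
      using sum_nonneg[of I h] h sum_h by auto
    then have "\<eta> * ?G \<ge> 0"
      using n by (auto simp: zero_le_mult_iff intro!: sum_nonneg g)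
    then have "card I * (\<eta> * ?G) \<le> (2 * (real (card I) - 1)) * (\<eta> * ?G)"
      using n by (intro mult_right_mono) auto
    then show ?thesis
      by (simp add: algebra_simps)
  qed
  finally show ?thesis
    using n by simp
qed

lemma sum_sq: "(\<Sum>i\<in>I. \<Sum>a\<in>I. \<Sum>p\<in>P. (A i (q p a))\<^sup>2) = card P * S2"
proof -
  have "(\<Sum>i\<in>I. \<Sum>a\<in>I. \<Sum>p\<in>P. (A i (q p a))\<^sup>2) = (\<Sum>i\<in>I. \<Sum>p\<in>P. \<Sum>a\<in>I. (A i (q p a))\<^sup>2)"
    by (intro sum.cong refl sum.swap)
  also have "\<dots> = (\<Sum>i\<in>I. \<Sum>p\<in>P. \<Sum>a\<in>I. (A i a)\<^sup>2)"
    by (intro sum.cong refl sum_q)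
  finally show ?thesis
    by (simp add: S2_def sum_distrib_left)
qed

section \<open>Bounds for the remainders in terms of a truncated kernel\<close>

definition tr :: "real \<Rightarrow> 'i \<Rightarrow> 'i \<Rightarrow> 'p \<Rightarrow> real" where
  "tr u i j p = min 2 \<bar>u * D i j p\<bar>"

lemma tr_nonneg: "tr u i j p \<ge> 0"
  by (simp add: tr_def)

lemma tr_refl [simp]: "tr u i i p = 0"
  by (simp add: tr_def)

lemma tr_commute: "tr u i j p = tr u j i p"
  by (simp add: tr_def D_commute)

lemma tr_sw: "\<lbrakk>i \<in> I; j \<in> I; p \<in> P\<rbrakk> \<Longrightarrow> tr u i j (sw i j p) = tr u i j p"
  by (simp add: tr_def D_sw)

definition K0 :: "real \<Rightarrow> real" where
  "K0 u = (\<Sum>i\<in>I. \<Sum>a\<in>I. \<Sum>p\<in>P. (A i (q p a))\<^sup>2 * tr u i a p)"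

definition e :: "real \<Rightarrow> 'p \<Rightarrow> complex" where "e u p = cis (u * T p)"

lemma e_sw: "\<lbrakk>i \<in> I; j \<in> I; p \<in> P\<rbrakk> \<Longrightarrow> e u (sw i j p) = e u p * cis (u * D i j p)"
  by (simp add: e_def T_sw D_def distrib_left cis_mult)

lemma norm_e [simp]: "cmod (e u p) = 1"
  by (simp add: e_def)

lemma e_sw_diff:
  assumes "i \<in> I" "j \<in> I" "p \<in> P"
  shows "cmod (e u (sw i j p) - e u p) \<le> tr u i j p"
proof -
  have "e u (sw i j p) - e u p = e u p * (cis (u * D i j p) - 1)"
    using assms by (simp add: e_sw algebra_simps)
  then show ?thesis
    using norm_cis_diff_1_le[of "u * D i j p"] by (simp add: norm_mult tr_def)
qed

lemma e_sw_taylor: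
  assumes "i \<in> I" "j \<in> I" "p \<in> P"
  shows "cmod (e u (sw i j p) - e u p - \<i> * u * D i j p * e u p) \<le> \<bar>u\<bar> * \<bar>D i j p\<bar> * tr u i j p"
proof -
  have "e u (sw i j p) - e u p - \<i> * u * D i j p * e u p =
      e u p * (cis (u * D i j p) - 1 - \<i> * (u * D i j p))"
    using assms by (simp add: e_sw algebra_simps)
  then show ?thesis
    using norm_cis_taylor_1_le[of "u * D i j p"] by (simp add: norm_mult tr_def abs_mult)
qed

text \<open>The kernel is symmetric in \<open>i\<close> and \<open>a\<close> and invariant under
  their exchange. These two symmetries carry the four entries of \<open>D i a p\<close> into one
  another, so each of them yields the same sum.\<close>

lemma K0_variants:
  "(\<Sum>i\<in>I. \<Sum>a\<in>I. \<Sum>p\<in>P. (A a (q p i))\<^sup>2 * tr u i a p) = K0 u"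
  "(\<Sum>i\<in>I. \<Sum>a\<in>I. \<Sum>p\<in>P. (A i (q p i))\<^sup>2 * tr u i a p) = K0 u"
  "(\<Sum>i\<in>I. \<Sum>a\<in>I. \<Sum>p\<in>P. (A a (q p a))\<^sup>2 * tr u i a p) = K0 u"
proof -
  show *: "(\<Sum>i\<in>I. \<Sum>a\<in>I. \<Sum>p\<in>P. (A a (q p i))\<^sup>2 * tr u i a p) = K0 u"
    unfolding K0_def by (subst sum.swap) (simp add: tr_commute)
  have sw: "(\<Sum>p\<in>P. (A i (q p a))\<^sup>2 * tr u i a p) = (\<Sum>p\<in>P. (A i (q p i))\<^sup>2 * tr u i a p)"
    if "i \<in> I" "a \<in> I" for i a
    using sum_sw[OF that, of "\<lambda>p. (A i (q p i))\<^sup>2 * tr u i a p"]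
    by (simp add: q_sw_apply tr_sw that cong: sum.cong)
  then show **: "(\<Sum>i\<in>I. \<Sum>a\<in>I. \<Sum>p\<in>P. (A i (q p i))\<^sup>2 * tr u i a p) = K0 u"
    unfolding K0_def by (simp cong: sum.cong)
  show "(\<Sum>i\<in>I. \<Sum>a\<in>I. \<Sum>p\<in>P. (A a (q p a))\<^sup>2 * tr u i a p) = K0 u"
    unfolding **[symmetric] by (subst sum.swap) (simp add: tr_commute)
qed

lemma norm_R1_le: "cmod (R1 (\<i> * u) (e u)) \<le> 4 * \<bar>u\<bar> * K0 u"
proof -
  \<comment> \<open>The inequality of arithmetic and geometric means, for \<open>A i (q p a)\<close>
    against each of the four entries of \<open>D\<close>. Every square sums to \<open>K0 u\<close>
    by \<open>K0_variants\<close>, which gives the constant \<open>4 = 2 + 4 / 2\<close>.\<close>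
  have pt: "\<bar>A i (q p a)\<bar> * \<bar>D i a p\<bar> \<le> 2 * (A i (q p a))\<^sup>2 +
      1/2 * ((A i (q p a))\<^sup>2 + (A a (q p i))\<^sup>2 + (A i (q p i))\<^sup>2 + (A a (q p a))\<^sup>2)" for i a p
  proof -
    have 1: "\<bar>x\<bar> * \<bar>y\<bar> \<le> x\<^sup>2 / 2 + y\<^sup>2 / 2" for x y :: real
      using sum_squares_bound[of "\<bar>x\<bar>" "\<bar>y\<bar>"] by simp
    have "\<bar>D i a p\<bar> \<le> \<bar>A i (q p a)\<bar> + \<bar>A a (q p i)\<bar> + \<bar>A i (q p i)\<bar> + \<bar>A a (q p a)\<bar>"
      unfolding D_def by linarith
    from mult_left_mono[OF this abs_ge_zero[of "A i (q p a)"]]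
    show ?thesis
      using 1[of "A i (q p a)" "A i (q p a)"] 1[of "A i (q p a)" "A a (q p i)"]
        1[of "A i (q p a)" "A i (q p i)"] 1[of "A i (q p a)" "A a (q p a)"]
      unfolding distrib_left by linarith
  qed
  have "cmod (R1 (\<i> * u) (e u)) \<le>
     (\<Sum>i\<in>I. \<Sum>a\<in>I. \<Sum>p\<in>P. \<bar>A i (q p a)\<bar> * (\<bar>u\<bar> * \<bar>D i a p\<bar> * tr u i a p))"
    unfolding R1_def
    by (intro sum_norm_le order.trans[OF norm_sum sum_mono])
       (auto simp: norm_mult intro!: mult_left_mono e_sw_taylor)
  also have "\<dots> \<le> (\<Sum>i\<in>I. \<Sum>a\<in>I. \<Sum>p\<in>P. \<bar>u\<bar> * ((2 * (A i (q p a))\<^sup>2 +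
      1/2 * ((A i (q p a))\<^sup>2 + (A a (q p i))\<^sup>2 + (A i (q p i))\<^sup>2 + (A a (q p a))\<^sup>2)) * tr u i a p))"
    using mult_left_mono[OF mult_right_mono[OF pt tr_nonneg] abs_ge_zero, of u]
    by (intro sum_mono) (simp add: mult_ac)
  also have "\<dots> = \<bar>u\<bar> * (2 * K0 u + 1/2 * (K0 u +
      (\<Sum>i\<in>I. \<Sum>a\<in>I. \<Sum>p\<in>P. (A a (q p i))\<^sup>2 * tr u i a p) +
      (\<Sum>i\<in>I. \<Sum>a\<in>I. \<Sum>p\<in>P. (A i (q p i))\<^sup>2 * tr u i a p) +
      (\<Sum>i\<in>I. \<Sum>a\<in>I. \<Sum>p\<in>P. (A a (q p a))\<^sup>2 * tr u i a p)))"
    unfolding K0_def by (simp only: sum_distrib_left sum.distrib distrib_left distrib_right mult.assoc)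
  finally show ?thesis
    unfolding K0_variants by simp
qed

lemma norm_R3_le: "cmod (R3 (e u)) \<le> K0 u"
  unfolding R3_def K0_def
  by (intro sum_norm_le order.trans[OF norm_sum sum_mono])
     (auto simp: norm_mult norm_power intro!: mult_left_mono e_sw_diff)

text \<open>The product of two entries is split into squares. The first square sits in the random
  column \<open>q p a\<close>, which the exchange of \<open>i\<close> and \<open>b\<close> leaves
  alone, so it is not of the form covered by \<open>K0\<close>; both parts are treated in
  \<open>norm_R2_bound\<close>.\<close>

lemma norm_R2_le:
  "cmod (R2 (e u)) \<le> (\<Sum>a\<in>I. \<Sum>i\<in>I-{a}. \<Sum>b\<in>I-{a}.
     1/2 * (\<Sum>p\<in>P. (A i (q p a))\<^sup>2 * tr u i b p) + 1/2 * (\<Sum>p\<in>P. (A a (q p b))\<^sup>2 * tr u i b p))"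
proof -
  have pt: "\<bar>A i (q p a)\<bar> * \<bar>A a (q p b)\<bar> * cmod (e u (sw i b p) - e u p) \<le>
      1/2 * ((A i (q p a))\<^sup>2 * tr u i b p) + 1/2 * ((A a (q p b))\<^sup>2 * tr u i b p)"
    if "i \<in> I" "b \<in> I" "p \<in> P" for i a b p
  proof -
    have "\<bar>A i (q p a)\<bar> * \<bar>A a (q p b)\<bar> \<le> 1/2 * ((A i (q p a))\<^sup>2 + (A a (q p b))\<^sup>2)"
      using sum_squares_bound[of "\<bar>A i (q p a)\<bar>" "\<bar>A a (q p b)\<bar>"] by simp
    from mult_mono[OF this e_sw_diff[OF that]] show ?thesis
      by (simp add: algebra_simps)
  qed
  show ?thesis
    unfolding R2_def sum_distrib_left sum.distrib[symmetric]
    by (intro sum_norm_le order.trans[OF norm_sum sum_mono])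
       (use pt in \<open>auto simp: norm_mult abs_mult\<close>)
qed

definition B :: "real \<Rightarrow> 'i \<Rightarrow> 'i \<Rightarrow> real" where
  "B \<epsilon> i j = of_bool (\<bar>A i j\<bar> > \<epsilon>)"

lemma B_nonneg: "B \<epsilon> i j \<ge> 0"
  by (simp add: B_def)

text \<open>If all four entries are at most \<open>\<epsilon>\<close>, then
  \<open>\<bar>D i j p\<bar> \<le> 4 * \<epsilon>\<close>. Otherwise some indicator equals 1, and
  the cap 2 in \<open>tr\<close> is enough.\<close>

lemma tr_le: "tr u i j p \<le> 4 * \<bar>u\<bar> * \<epsilon> +
    2 * (B \<epsilon> i (q p j) + B \<epsilon> j (q p i) + B \<epsilon> i (q p i) + B \<epsilon> j (q p j))" if "\<epsilon> \<ge> 0"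
proof (cases "\<bar>A i (q p j)\<bar> \<le> \<epsilon> \<and> \<bar>A j (q p i)\<bar> \<le> \<epsilon> \<and> \<bar>A i (q p i)\<bar> \<le> \<epsilon> \<and> \<bar>A j (q p j)\<bar> \<le> \<epsilon>")
  case True
  then have "\<bar>D i j p\<bar> \<le> 4 * \<epsilon>"
    unfolding D_def by linarith
  from mult_left_mono[OF this abs_ge_zero[of u]]
  moreover have "tr u i j p \<le> \<bar>u\<bar> * \<bar>D i j p\<bar>"
    by (simp add: tr_def abs_mult)
  ultimately have "tr u i j p \<le> 4 * \<bar>u\<bar> * \<epsilon>"
    by simp
  then show ?thesis
    using B_nonneg[of \<epsilon>] by (smt (verit))
next
  case False
  then have "B \<epsilon> i (q p j) + B \<epsilon> j (q p i) + B \<epsilon> i (q p i) + B \<epsilon> j (q p j) \<ge> 1"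
    by (auto simp: B_def)
  moreover have "tr u i j p \<le> 2" "4 * \<bar>u\<bar> * \<epsilon> \<ge> 0"
    using that by (auto simp: tr_def)
  moreover have "t \<le> w + 2 * s" if "t \<le> 2" "w \<ge> 0" "s \<ge> 1" for t w s :: real
    using that by simp
  ultimately show ?thesis
    by blast
qed

end

section \<open>Lindeberg estimates in one stratum\<close>

locale swap_model_lindeberg = swap_model P I q sw A T
  for P :: "'p set" and I :: "'i set" and q sw A T +
  fixes u \<epsilon> \<eta> c :: real
  assumes eps: "\<epsilon> > 0" and c_eq: "c = 4 * \<bar>u\<bar> * \<epsilon>"
    and row_count: "i \<in> I \<Longrightarrow> (\<Sum>j\<in>I. B \<epsilon> i j) \<le> card I * \<eta>"
    and col_count: "j \<in> I \<Longrightarrow> (\<Sum>i\<in>I. B \<epsilon> i j) \<le> card I * \<eta>"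
begin

definition X :: "'i \<Rightarrow> 'i \<Rightarrow> real" where "X i a = (\<Sum>p\<in>P. (A i (q p a))\<^sup>2)"

text \<open>The case that \<open>pair_bound\<close> excludes: the square and the indicator look at
  the same random column \<open>q p a\<close>. For \<open>x = i\<close> this is the Lindeberg
  quantity; otherwise a sum over the row \<open>x\<close> counts the large entries of one
  column.\<close>

definition Y :: "'i \<Rightarrow> 'i \<Rightarrow> 'i \<Rightarrow> real" where
  "Y i a x = (\<Sum>p\<in>P. (A i (q p a))\<^sup>2 * B \<epsilon> x (q p a))"

definition L2 :: real where "L2 = (\<Sum>i\<in>I. \<Sum>j\<in>I. (A i j)\<^sup>2 * B \<epsilon> i j)"

lemma eta_nonneg: "\<eta> \<ge> 0"
proof -
  obtain i where "i \<in> I" using card_I by fastforce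
  then have "0 \<le> card I * \<eta>"
    using row_count[of i] sum_nonneg[of I "B \<epsilon> i"] by (auto simp: B_nonneg)
  then show ?thesis using card_I by (auto simp: zero_le_mult_iff)
qed

lemma X_nonneg: "X i a \<ge> 0" and Y_nonneg: "Y i a x \<ge> 0"
  by (auto simp: X_def Y_def intro!: sum_nonneg mult_nonneg_nonneg B_nonneg)

lemma sum_X: "(\<Sum>i\<in>I. \<Sum>a\<in>I. X i a) = card P * S2"
  by (simp add: X_def sum_sq)

lemma S2_nonneg: "S2 \<ge> 0"
  by (auto simp: S2_def intro!: sum_nonneg)

lemma marginal_Y: "a \<in> I \<Longrightarrow> card I * Y i a x = card P * (\<Sum>k\<in>I. (A i k)\<^sup>2 * B \<epsilon> x k)"
  unfolding Y_def by (rule marginal)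

lemma sum_Y_same: "(\<Sum>i\<in>I. \<Sum>a\<in>I. Y i a i) = card P * L2"
proof -
  have "(\<Sum>i\<in>I. \<Sum>a\<in>I. card I * Y i a i) = card I * (card P * L2)"
    by (simp add: marginal_Y L2_def sum_distrib_left mult_ac cong: sum.cong)
  then show ?thesis
    using card_I by (simp flip: sum_distrib_left)
qed

text \<open>Interchanging the sums leaves, next to each square \<open>(A i k)\<^sup>2\<close>, the
  number of rows \<open>a\<close> with a large entry in column \<open>k\<close>, and
  \<open>col_count\<close> applies.\<close>

lemma sum_Y_diag: "(\<Sum>i\<in>I. \<Sum>a\<in>I. Y i a a) \<le> \<eta> * (card P * S2)"
proof -
  have eq: "card I * (\<Sum>i\<in>I. \<Sum>a\<in>I. Y i a a) =
      card P * (\<Sum>i\<in>I. \<Sum>a\<in>I. \<Sum>k\<in>I. (A i k)\<^sup>2 * B \<epsilon> a k)"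
    by (simp add: marginal_Y sum_distrib_left cong: sum.cong)
  have "(\<Sum>i\<in>I. \<Sum>a\<in>I. \<Sum>k\<in>I. (A i k)\<^sup>2 * B \<epsilon> a k) =
      (\<Sum>i\<in>I. \<Sum>k\<in>I. (A i k)\<^sup>2 * (\<Sum>a\<in>I. B \<epsilon> a k))"
    unfolding sum_distrib_left by (intro sum.cong refl sum.swap)
  also have "\<dots> \<le> (\<Sum>i\<in>I. \<Sum>k\<in>I. (A i k)\<^sup>2 * (card I * \<eta>))"
    by (intro sum_mono mult_left_mono col_count) auto
  also have "\<dots> = S2 * (card I * \<eta>)"
    by (simp add: S2_def sum_distrib_right)
  finally have le: "(\<Sum>i\<in>I. \<Sum>a\<in>I. \<Sum>k\<in>I. (A i k)\<^sup>2 * B \<epsilon> a k) \<le> S2 * (card I * \<eta>)" .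
  have "card I * (\<Sum>i\<in>I. \<Sum>a\<in>I. Y i a a) \<le> card I * (\<eta> * (card P * S2))"
    using mult_left_mono[OF le, of "card P"] unfolding eq by (simp add: mult_ac)
  then show ?thesis
    using card_I by simp
qed

lemma sum_Y_col: "(\<Sum>x\<in>I. Y i a x) \<le> card I * \<eta> * X i a" if "a \<in> I"
proof -
  have "(\<Sum>x\<in>I. Y i a x) = (\<Sum>p\<in>P. (A i (q p a))\<^sup>2 * (\<Sum>x\<in>I. B \<epsilon> x (q p a)))"
    unfolding Y_def by (subst sum.swap) (simp add: sum_distrib_left)
  also have "\<dots> \<le> (\<Sum>p\<in>P. (A i (q p a))\<^sup>2 * (card I * \<eta>))"
    by (intro sum_mono mult_left_mono col_count q_in that) auto
  finally show ?thesis
    by (simp add: X_def sum_distrib_left mult_ac)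
qed

text \<open>In a different column the indicator is nearly independent of the square, and its mean is
  the proportion of large entries in row \<open>x\<close>.\<close>

lemma other_col:
  assumes "a \<in> I" "y \<in> I" "a \<noteq> y" "x \<in> I"
  shows "(\<Sum>p\<in>P. (A i (q p a))\<^sup>2 * B \<epsilon> x (q p y)) \<le> 2 * \<eta> * X i a"
  using pair_bound[of a y "\<lambda>k. (A i k)\<^sup>2" "B \<epsilon> x" \<eta>] assms
  by (simp add: X_def B_nonneg row_count)

lemma tr_le_sum:
  "(\<Sum>p\<in>P. (A r (q p a))\<^sup>2 * tr u i j p) \<le> c * X r a +
     2 * ((\<Sum>p\<in>P. (A r (q p a))\<^sup>2 * B \<epsilon> i (q p j)) + (\<Sum>p\<in>P. (A r (q p a))\<^sup>2 * B \<epsilon> j (q p i)) +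
      (\<Sum>p\<in>P. (A r (q p a))\<^sup>2 * B \<epsilon> i (q p i)) + (\<Sum>p\<in>P. (A r (q p a))\<^sup>2 * B \<epsilon> j (q p j)))"
proof -
  have "(\<Sum>p\<in>P. (A r (q p a))\<^sup>2 * tr u i j p) \<le> (\<Sum>p\<in>P. (A r (q p a))\<^sup>2 * (c +
    2 * (B \<epsilon> i (q p j) + B \<epsilon> j (q p i) + B \<epsilon> i (q p i) + B \<epsilon> j (q p j))))"
    unfolding c_eq using eps by (intro sum_mono mult_left_mono tr_le) auto
  also have "\<dots> = c * X r a +
     2 * ((\<Sum>p\<in>P. (A r (q p a))\<^sup>2 * B \<epsilon> i (q p j)) + (\<Sum>p\<in>P. (A r (q p a))\<^sup>2 * B \<epsilon> j (q p i)) +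
      (\<Sum>p\<in>P. (A r (q p a))\<^sup>2 * B \<epsilon> i (q p i)) + (\<Sum>p\<in>P. (A r (q p a))\<^sup>2 * B \<epsilon> j (q p j)))"
    by (simp add: X_def distrib_left sum.distrib sum_distrib_left mult_ac)
  finally show ?thesis .
qed

lemma c_nonneg: "c \<ge> 0"
  using eps by (simp add: c_eq)

text \<open>For \<open>i \<noteq> a\<close>, the two indicators in column \<open>q p i\<close> cost
  \<open>2 * \<eta>\<close> each by \<open>other_col\<close>, and the two in column
  \<open>q p a\<close> are \<open>Y i a i\<close> and \<open>Y i a a\<close>. With the factor 2 of
  \<open>tr_le_sum\<close> this gives \<open>8 * \<eta>\<close>, to which \<open>sum_Y_diag\<close>
  adds \<open>2 * \<eta>\<close>.\<close>

lemma K0_le: "K0 u \<le> card P * ((c + 10 * \<eta>) * S2 + 2 * L2)"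
proof -
  have "(\<Sum>p\<in>P. (A i (q p a))\<^sup>2 * tr u i a p) \<le> (c + 8 * \<eta>) * X i a + 2 * Y i a i + 2 * Y i a a"
    if "i \<in> I" "a \<in> I" for i a
  proof (cases "i = a")
    case True
    then show ?thesis
      using X_nonneg[of i a] Y_nonneg[of i a i] c_nonneg eta_nonneg by simp
  next
    case False
    then show ?thesis
      using tr_le_sum[of i a i a] other_col[of a i a i] other_col[of a i i i] that
      by (simp add: Y_def algebra_simps)
  qed
  then have "K0 u \<le> (\<Sum>i\<in>I. \<Sum>a\<in>I. (c + 8 * \<eta>) * X i a + 2 * Y i a i + 2 * Y i a a)"
    unfolding K0_def by (intro sum_mono)
  also have "\<dots> = (c + 8 * \<eta>) * (card P * S2) + 2 * (card P * L2) + 2 * (\<Sum>i\<in>I. \<Sum>a\<in>I. Y i a a)"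
    by (simp add: sum.distrib sum_X sum_Y_same flip: sum_distrib_left)
  finally show ?thesis
    using sum_Y_diag by (simp add: algebra_simps)
qed

text \<open>For the first square, column \<open>q p a\<close> differs from both exchanged columns,
  so \<open>other_col\<close> handles all four indicators at a cost of \<open>16 * \<eta>\<close>.
  For the second, two indicators share the column \<open>q p b\<close> and become
  \<open>Y a b i\<close> and \<open>Y a b b\<close>; their rows differ from \<open>a\<close>, so no
  \<open>L2\<close> arises. With the halves from \<open>norm_R2_le\<close>, \<open>\<eta>\<close>
  occurs \<open>8 + 4 + 1 + 1 = 14\<close> times.\<close>

lemma norm_R2_bound: "cmod (R2 (e u)) \<le> card I * (card P * S2) * (c + 14 * \<eta>)"
proof -
  define \<alpha> where "\<alpha> = 1/2 * (c + 16 * \<eta>)"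
  define \<beta> where "\<beta> = 1/2 * (c + 8 * \<eta>)"
  define G where "G a i b = \<alpha> * X i a + \<beta> * X a b + Y a b i + Y a b b" for a i b
  have G0: "G a i b \<ge> 0" for a i b
    unfolding G_def \<alpha>_def \<beta>_def using c_nonneg eta_nonneg X_nonneg Y_nonneg
    by (intro add_nonneg_nonneg mult_nonneg_nonneg) auto
  have "1/2 * (\<Sum>p\<in>P. (A i (q p a))\<^sup>2 * tr u i b p) + 1/2 * (\<Sum>p\<in>P. (A a (q p b))\<^sup>2 * tr u i b p)
      \<le> G a i b" if "a \<in> I" "i \<in> I - {a}" "b \<in> I - {a}" for a i b
  proof (cases "i = b")
    case True
    then show ?thesis using G0[of a b b] by simp
  next
    case False
    have "(\<Sum>p\<in>P. (A i (q p a))\<^sup>2 * tr u i b p) \<le> (c + 16 * \<eta>) * X i a"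
      using tr_le_sum[of i a i b] other_col[of a i b i] other_col[of a b i i]
        other_col[of a i i i] other_col[of a b b i] that
        not_sym[of i a] not_sym[of b a]
      by (simp add: algebra_simps)
    moreover have "(\<Sum>p\<in>P. (A a (q p b))\<^sup>2 * tr u i b p) \<le>
        (c + 8 * \<eta>) * X a b + 2 * Y a b i + 2 * Y a b b"
      using tr_le_sum[of a b i b] other_col[of b i b a] other_col[of b i i a] that False
      by (simp add: algebra_simps Y_def)
    ultimately show ?thesis
      by (simp add: G_def \<alpha>_def \<beta>_def)
  qed
  then have "cmod (R2 (e u)) \<le> (\<Sum>a\<in>I. \<Sum>i\<in>I-{a}. \<Sum>b\<in>I-{a}. G a i b)"
    by (intro order.trans[OF norm_R2_le] sum_mono)
  also have "\<dots> \<le> (\<Sum>a\<in>I. \<Sum>i\<in>I. \<Sum>b\<in>I-{a}. G a i b)"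
    by (intro sum_mono sum_mono2 sum_nonneg) (auto simp: finite_I G0)
  also have "\<dots> \<le> (\<Sum>a\<in>I. \<Sum>i\<in>I. \<Sum>b\<in>I. G a i b)"
    by (intro sum_mono sum_mono2 sum_nonneg) (auto simp: finite_I G0)
  also have "\<dots> = \<alpha> * (\<Sum>a\<in>I. \<Sum>i\<in>I. \<Sum>b\<in>I. X i a) +
      \<beta> * (\<Sum>a\<in>I. \<Sum>i\<in>I. \<Sum>b\<in>I. X a b) +
      (\<Sum>a\<in>I. \<Sum>i\<in>I. \<Sum>b\<in>I. Y a b i) + (\<Sum>a\<in>I. \<Sum>i\<in>I. \<Sum>b\<in>I. Y a b b)"
    by (simp only: G_def sum.distrib sum_distrib_left)
  also have "(\<Sum>a\<in>I. \<Sum>i\<in>I. \<Sum>b\<in>I. X i a) = card I * (card P * S2)"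
    by (subst sum.swap) (simp add: sum_X flip: sum_distrib_left)
  also have "(\<Sum>a\<in>I. \<Sum>i\<in>I. \<Sum>b\<in>I. X a b) = card I * (card P * S2)"
    by (simp add: sum_X flip: sum_distrib_left)
  also have "(\<Sum>a\<in>I. \<Sum>i\<in>I. \<Sum>b\<in>I. Y a b i) = (\<Sum>a\<in>I. \<Sum>b\<in>I. \<Sum>i\<in>I. Y a b i)"
    by (intro sum.cong refl sum.swap)
  also have "\<dots> \<le> (\<Sum>a\<in>I. \<Sum>b\<in>I. card I * \<eta> * X a b)"
    by (intro sum_mono sum_Y_col)
  also have "\<dots> = card I * \<eta> * (card P * S2)"
    by (simp add: sum_X flip: sum_distrib_left)
  also have "(\<Sum>a\<in>I. \<Sum>i\<in>I. \<Sum>b\<in>I. Y a b b) \<le> card I * (\<eta> * (card P * S2))"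
    using sum_Y_diag by (auto simp flip: sum_distrib_left intro!: mult_left_mono)
  finally show ?thesis
    by (simp add: \<alpha>_def \<beta>_def algebra_simps)
qed

text \<open>Division of \<open>stein_identity\<close> by \<open>n * (n - 1)\<close>. The bound for
  \<open>R2\<close> enters once and the bound for \<open>K0\<close> five times, hence
  \<open>6 = 1 + 5\<close>, \<open>64 = 14 + 5 * 10\<close> and \<open>10 = 5 * 2\<close>.\<close>

theorem stein_bound:
  "cmod ((\<Sum>p\<in>P. complex_of_real (\<Sum>i\<in>I. A i (q p i)) * e u p) -
      \<i> * u * complex_of_real (S2 / (real (card I) - 1)) * (\<Sum>p\<in>P. e u p))
    \<le> \<bar>u\<bar> * card P * ((6 * c + 64 * \<eta>) * (S2 / (real (card I) - 1)) + 10 * (L2 / card I))"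
proof -
  define n where "n = real (card I)"
  have n: "n \<ge> 2" using card_I by (simp add: n_def)
  define W where "W = (\<Sum>p\<in>P. complex_of_real (\<Sum>i\<in>I. A i (q p i)) * e u p)"
  define E where "E = (\<Sum>p\<in>P. e u p)"
  define r1 r2 r3 where "r1 = R1 (\<i> * u) (e u)" and "r2 = R2 (e u)" and "r3 = R3 (e u)"
  define err where "err = \<i> * u * (r2 + r3) + complex_of_real (n - 1) * r1"
  have K: "K0 u \<ge> 0"
    unfolding K0_def by (intro sum_nonneg mult_nonneg_nonneg tr_nonneg) auto
  have eq: "complex_of_real n * complex_of_real (n - 1) * W =
      \<i> * u * complex_of_real n * complex_of_real S2 * E + err"
    using stein_identity[of "e u" "\<i> * u"]
    by (simp add: n_def W_def E_def err_def r1_def r2_def r3_def)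
  have nz: "complex_of_real n \<noteq> 0" "complex_of_real (n - 1) \<noteq> 0"
    using n by (simp_all del: of_real_diff)
  have "W = (\<i> * u * complex_of_real n * complex_of_real S2 * E + err) /
      (complex_of_real n * complex_of_real (n - 1))"
    unfolding eq[symmetric] using nz by (simp del: of_real_diff)
  also have "\<dots> = \<i> * u * complex_of_real (S2 / (n - 1)) * E +
      err / (complex_of_real n * complex_of_real (n - 1))"
    using nz by (simp add: add_divide_distrib del: of_real_diff)
  finally have "W - \<i> * u * complex_of_real (S2 / (n - 1)) * E =
      err / (complex_of_real n * complex_of_real (n - 1))"
    by simp
  then have norm_eq: "cmod (W - \<i> * u * complex_of_real (S2 / (n - 1)) * E) = cmod err / (n * (n - 1))"
    using n by (simp add: norm_divide norm_mult del: of_real_diff)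
  have "cmod err \<le> cmod (\<i> * u * (r2 + r3)) + cmod (complex_of_real (n - 1) * r1)"
    unfolding err_def by (rule norm_triangle_ineq)
  also have "\<dots> = \<bar>u\<bar> * cmod (r2 + r3) + (n - 1) * cmod r1"
    using n by (simp add: norm_mult del: of_real_diff)
  also have "\<dots> \<le> \<bar>u\<bar> * (cmod r2 + cmod r3) + (n - 1) * cmod r1"
    by (intro add_right_mono mult_left_mono norm_triangle_ineq) auto
  also have "\<dots> \<le> \<bar>u\<bar> * (n * (card P * S2) * (c + 14 * \<eta>) + K0 u) + (n - 1) * (4 * \<bar>u\<bar> * K0 u)"
    using n norm_R2_bound norm_R3_le norm_R1_le unfolding r1_def r2_def r3_def
    by (intro add_mono mult_left_mono) (auto simp: n_def)
  also have "\<dots> = \<bar>u\<bar> * (n * (card P * S2) * (c + 14 * \<eta>) + (1 + 4 * (n - 1)) * K0 u)"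
    by (simp add: algebra_simps)
  \<comment> \<open>\<open>1 + 4 * (n - 1) \<le> 5 * (n - 1)\<close> because
    \<open>n \<ge> 2\<close>.\<close>
  also have "\<dots> \<le> \<bar>u\<bar> * (n * (card P * S2) * (c + 14 * \<eta>) + (5 * (n - 1)) * K0 u)"
    using n K by (intro mult_left_mono add_left_mono mult_right_mono) auto
  also have "\<dots> \<le> \<bar>u\<bar> * (n * (card P * S2) * (c + 14 * \<eta>) + (5 * (n - 1)) * (card P * ((c + 10 * \<eta>) * S2 + 2 * L2)))"
    using n K0_le by (intro mult_left_mono add_left_mono) auto
  \<comment> \<open>Only the part with \<open>S2\<close> is relaxed from \<open>n - 1\<close> to
    \<open>n\<close>. The division then leaves \<open>S2 / (n - 1)\<close> and
    \<open>L2 / n\<close>, the normalizations used in the variance and in the Lindeberg sum.\<close>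
  also have "\<dots> \<le> \<bar>u\<bar> * (n * (card P * S2) * (c + 14 * \<eta>) + (5 * n * (card P * ((c + 10 * \<eta>) * S2)) +
      10 * (n - 1) * (card P * L2)))"
  proof -
    have "(5 * (n - 1)) * (card P * ((c + 10 * \<eta>) * S2)) \<le> (5 * n) * (card P * ((c + 10 * \<eta>) * S2))"
      using c_nonneg eta_nonneg S2_nonneg by (intro mult_right_mono) auto
    then show ?thesis
      by (intro mult_left_mono add_left_mono) (auto simp: algebra_simps)
  qed
  also have "\<dots> = \<bar>u\<bar> * card P * (n * S2 * (6 * c + 64 * \<eta>) + 10 * (n - 1) * L2)"
    by (simp add: algebra_simps)
  finally have "cmod (W - \<i> * u * complex_of_real (S2 / (n - 1)) * E) \<le>
      \<bar>u\<bar> * card P * (n * S2 * (6 * c + 64 * \<eta>) + 10 * (n - 1) * L2) / (n * (n - 1))"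
    unfolding norm_eq using n by (intro divide_right_mono) auto
  also have "\<dots> = \<bar>u\<bar> * card P * ((6 * c + 64 * \<eta>) * (S2 / (n - 1)) + 10 * (L2 / n))"
  proof -
    have "(n * S2 * k + 10 * m * L2) / (n * m) = k * (S2 / m) + 10 * (L2 / n)" if "m \<noteq> 0" for k m
      using n that by (simp add: field_simps)
    from this[of "n - 1" "6 * c + 64 * \<eta>"] n have
      "(n * S2 * (6 * c + 64 * \<eta>) + 10 * (n - 1) * L2) / (n * (n - 1)) =
        (6 * c + 64 * \<eta>) * (S2 / (n - 1)) + 10 * (L2 / n)"
      by simp
    then show ?thesis
      by (simp only: times_divide_eq_right[symmetric])
  qed
  finally show ?thesis
    by (simp only: n_def W_def E_def)
qed

end

section \<open>From an approximate differential equation to the Gaussian characteristic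
  function\<close>

lemma char_fun_near_gaussian:
  fixes T :: "'p \<Rightarrow> real" and u \<delta> :: real
  assumes fin: "finite P" and ne: "P \<noteq> {}"
    and stein: "\<And>v. \<bar>v\<bar> \<le> \<bar>u\<bar> \<Longrightarrow>
      cmod ((\<Sum>p\<in>P. complex_of_real (T p) * cis (v * T p)) - \<i> * v * (\<Sum>p\<in>P. cis (v * T p))) \<le> card P * \<delta>"
  shows "cmod ((\<Sum>p\<in>P. cis (u * T p)) / card P - complex_of_real (exp (- (u\<^sup>2) / 2))) \<le> \<bar>u\<bar> * \<delta>"
proof -
  define m where "m = real (card P)"
  have m: "m > 0" using fin ne by (simp add: m_def card_gt_0_iff)
  define \<phi> where "\<phi> v = (\<Sum>p\<in>P. cis (v * T p)) / complex_of_real m" for v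
  define d where "d v = (\<Sum>p\<in>P. complex_of_real (T p) * cis (v * T p)) - \<i> * v * (\<Sum>p\<in>P. cis (v * T p))" for v
  \<comment> \<open>The factor \<open>exp (v\<^sup>2 / 2)\<close> is the integrating factor of
    \<open>\<phi>' + v * \<phi> = 0\<close>, so the derivative \<open>g'\<close> is a multiple of
    the defect \<open>d\<close> alone.\<close>
  define g where "g v = exp (v\<^sup>2 / 2) *\<^sub>R \<phi> v" for v :: real
  define g' where "g' v = exp (v\<^sup>2 / 2) *\<^sub>R (\<i> / complex_of_real m * d v)" for v :: real
  have cis_der: "((\<lambda>v. cis (v * x)) has_vector_derivative \<i> * complex_of_real x * cis (v * x)) (at v within A)" for v x A
  proof -
    have "((\<lambda>z. exp (\<i> * (z * complex_of_real x))) has_field_derivative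
        \<i> * complex_of_real x * cis (v * x)) (at (complex_of_real v))"
      by (auto intro!: derivative_eq_intros simp: cis_conv_exp mult_ac)
    from has_vector_derivative_real_field[OF this] show ?thesis
      by (simp add: cis_conv_exp)
  qed
  have phi_der: "(\<phi> has_vector_derivative
      (\<Sum>p\<in>P. \<i> * complex_of_real (T p) * cis (v * T p)) / complex_of_real m) (at v within A)" for v A
    unfolding \<phi>_def
    by (intro has_vector_derivative_divide has_vector_derivative_sum cis_der)
  have g_der: "(g has_vector_derivative g' v) (at v within A)" for v A
  proof -
    have "((\<lambda>v. exp (v\<^sup>2 / 2)) has_real_derivative v * exp (v\<^sup>2 / 2)) (at v within A)"
      by (auto intro!: derivative_eq_intros)
    from has_vector_derivative_scaleR[OF this phi_der]
    have *: "(g has_vector_derivative exp (v\<^sup>2 / 2) *\<^sub>R ((\<Sum>p\<in>P. \<i> * complex_of_real (T p) * cis (v * T p)) / complex_of_real m)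
        + (v * exp (v\<^sup>2 / 2)) *\<^sub>R \<phi> v) (at v within A)"
      unfolding g_def .
    have "exp (v\<^sup>2 / 2) *\<^sub>R ((\<Sum>p\<in>P. \<i> * complex_of_real (T p) * cis (v * T p)) / complex_of_real m)
        + (v * exp (v\<^sup>2 / 2)) *\<^sub>R \<phi> v =
       exp (v\<^sup>2 / 2) *\<^sub>R ((\<Sum>p\<in>P. \<i> * complex_of_real (T p) * cis (v * T p)) / complex_of_real m + v * \<phi> v)"
      by (simp add: scaleR_conv_of_real algebra_simps)
    also have "(\<Sum>p\<in>P. \<i> * complex_of_real (T p) * cis (v * T p)) / complex_of_real m + v * \<phi> v =
       \<i> / complex_of_real m * d v"
      using m by (simp add: d_def \<phi>_def field_simps flip: sum_distrib_left)
    finally show ?thesis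
      using * by (simp add: g'_def)
  qed
  \<comment> \<open>Mean value inequality on a symmetric interval, which contains 0 and
    \<open>u\<close> whatever the sign of \<open>u\<close>; on it the integrating factor is largest
    at the end points.\<close>
  have "norm (g u - g 0) \<le> (exp (u\<^sup>2 / 2) * \<delta>) * norm (u - 0)"
  proof (rule differentiable_bound)
    show "convex {-\<bar>u\<bar>..\<bar>u\<bar>}" by simp
    show "(g has_derivative (\<lambda>h. h *\<^sub>R g' v)) (at v within {-\<bar>u\<bar>..\<bar>u\<bar>})" for v
      using g_der[of v] by (simp add: has_vector_derivative_def)
    show "onorm (\<lambda>h. h *\<^sub>R g' v) \<le> exp (u\<^sup>2 / 2) * \<delta>" if v: "v \<in> {-\<bar>u\<bar>..\<bar>u\<bar>}" for v
    proof -
      have v': "\<bar>v\<bar> \<le> \<bar>u\<bar>" using v by auto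
      have "cmod (g' v) = exp (v\<^sup>2 / 2) * (cmod (d v) / m)"
        using m by (simp add: g'_def norm_mult norm_divide)
      also have "\<dots> \<le> exp (u\<^sup>2 / 2) * \<delta>"
        using stein[OF v'] v' m abs_le_square_iff[of v u]
        by (intro mult_mono) (auto simp: d_def m_def field_simps)
      finally have "cmod (g' v) \<le> exp (u\<^sup>2 / 2) * \<delta>" .
      then show ?thesis
        by (intro onorm_le) (simp add: mult.commute mult_left_mono)
    qed
  qed auto
  moreover have "g 0 = 1"
    using m by (simp add: g_def \<phi>_def m_def)
  ultimately have *: "cmod (g u - 1) \<le> exp (u\<^sup>2 / 2) * (\<bar>u\<bar> * \<delta>)"
    by (simp add: mult_ac)
  have "\<phi> u - complex_of_real (exp (- (u\<^sup>2) / 2)) = exp (- (u\<^sup>2) / 2) *\<^sub>R (g u - 1)"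
    by (simp add: g_def scaleR_diff_right of_real_def flip: exp_add)
  then have "cmod (\<phi> u - complex_of_real (exp (- (u\<^sup>2) / 2))) = exp (- (u\<^sup>2) / 2) * cmod (g u - 1)"
    by simp
  also have "\<dots> \<le> exp (- (u\<^sup>2) / 2) * (exp (u\<^sup>2 / 2) * (\<bar>u\<bar> * \<delta>))"
    by (intro mult_left_mono *) simp
  also have "\<dots> = \<bar>u\<bar> * \<delta>"
    by (simp add: exp_minus)
  finally show ?thesis
    by (simp add: \<phi>_def m_def)
qed

section \<open>Summation over the strata\<close>

definition strat_sum :: "nat \<Rightarrow> (nat \<Rightarrow> nat) \<Rightarrow> (nat \<Rightarrow> nat \<Rightarrow> nat \<Rightarrow> real) \<Rightarrow> (nat \<Rightarrow> nat \<Rightarrow> nat) \<Rightarrow> real" where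
  "strat_sum S N b p = (\<Sum>s=1..S. \<Sum>i=1..N s. b s i (p s i))"

definition strat_swap :: "nat \<Rightarrow> nat \<Rightarrow> nat \<Rightarrow> (nat \<Rightarrow> nat \<Rightarrow> nat) \<Rightarrow> nat \<Rightarrow> nat \<Rightarrow> nat" where
  "strat_swap s i j p = p(s := p s \<circ> Transposition.transpose i j)"

lemma sum_swap_diff:
  fixes f g :: "'a \<Rightarrow> 'b::ab_group_add"
  assumes "finite I" "i \<in> I" "j \<in> I" "i \<noteq> j" and eq: "\<And>x. x \<in> I \<Longrightarrow> x \<noteq> i \<Longrightarrow> x \<noteq> j \<Longrightarrow> f x = g x"
  shows "sum f I = sum g I + (f i + f j - g i - g j)"
proof -
  have "sum h I = h i + (h j + sum h (I - {i} - {j}))" for h :: "'a \<Rightarrow> 'b"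
    using assms(1-4) by (simp add: sum.remove[of I i] sum.remove[of "I - {i}" j])
  moreover have "sum f (I - {i} - {j}) = sum g (I - {i} - {j})"
    by (intro sum.cong refl eq) auto
  ultimately show ?thesis
    by (simp add: algebra_simps)
qed

lemma strat_sum_swap:
  assumes s: "s \<in> {1..S}" and i: "i \<in> {1..N s}" and j: "j \<in> {1..N s}"
  shows "strat_sum S N b (strat_swap s i j p) =
    strat_sum S N b p + (b s i (p s j) + b s j (p s i) - b s i (p s i) - b s j (p s j))"
proof -
  have "strat_sum S N b r = (\<Sum>i=1..N s. b s i (r s i)) + (\<Sum>s\<in>{1..S}-{s}. \<Sum>i=1..N s. b s i (r s i))" for r
    unfolding strat_sum_def using s by (intro sum.remove) auto
  moreover have "(\<Sum>s'\<in>{1..S}-{s}. \<Sum>x=1..N s'. b s' x (strat_swap s i j p s' x)) =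
      (\<Sum>s\<in>{1..S}-{s}. \<Sum>i=1..N s. b s i (p s i))"
    by (intro sum.cong refl) (auto simp: strat_swap_def)
  moreover have "(\<Sum>x=1..N s. b s x (strat_swap s i j p s x)) =
      (\<Sum>x=1..N s. b s x (p s x)) + (b s i (p s j) + b s j (p s i) - b s i (p s i) - b s j (p s j))"
  proof (cases "i = j")
    case True
    then show ?thesis by (simp add: strat_swap_def)
  next
    case False
    have "(\<Sum>x=1..N s. b s x (strat_swap s i j p s x)) = (\<Sum>x=1..N s. b s x (p s x)) +
       (b s i (strat_swap s i j p s i) + b s j (strat_swap s i j p s j) - b s i (p s i) - b s j (p s j))"
      using i j False by (intro sum_swap_diff) (auto simp: strat_swap_def)
    then show ?thesis
      by (simp add: strat_swap_def)
  qed
  ultimately show ?thesis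
    by simp
qed

text \<open>Each stratum gives an instance in which \<open>P\<close> is the whole of
  \<open>strat_perms\<close> and \<open>T\<close> the sum over all strata; only the exchanges and
  the array are those of the stratum.\<close>

lemma swap_model_strat:
  assumes s: "s \<in> {1..S}" and N: "N s \<ge> 2"
    and cols: "\<And>j. j \<in> {1..N s} \<Longrightarrow> (\<Sum>i=1..N s. b s i j) = 0"
    and rows: "\<And>i. i \<in> {1..N s} \<Longrightarrow> (\<Sum>j=1..N s. b s i j) = 0"
  shows "swap_model (strat_perms S N) {1..N s} (\<lambda>p. p s) (strat_swap s) (b s) (strat_sum S N b)"
proof
  show "finite (strat_perms S N)" by (rule finite_strat_perms)
  show "p s permutes {1..N s}" if "p \<in> strat_perms S N" for p
    using that s by (auto simp: strat_perms_def)
  show "strat_swap s i j p \<in> strat_perms S N"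
    if "i \<in> {1..N s}" "j \<in> {1..N s}" "p \<in> strat_perms S N" for i j p
    using that s
    by (auto simp: strat_perms_def strat_swap_def intro!: permutes_compose[OF permutes_swap_id])
  show "strat_swap s i j (strat_swap s i j p) = p" for i j p
    by (auto simp: strat_swap_def fun_eq_iff)
  show "strat_swap s i j p s = p s \<circ> Transposition.transpose i j" for i j p
    by (simp add: strat_swap_def)
qed (use assms strat_sum_swap[where S=S and N=N and b=b] in auto)

text \<open>The Lindeberg sum of an array already scaled to variance 1. For the scaled array in
  \<open>strat_char_bound\<close> it equals \<open>strat_lindeberg\<close> of the original
  one.\<close>

definition strat_large :: "nat \<Rightarrow> (nat \<Rightarrow> nat) \<Rightarrow> (nat \<Rightarrow> nat \<Rightarrow> nat \<Rightarrow> real) \<Rightarrow> real \<Rightarrow> real" where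
  "strat_large S N b \<epsilon> = (\<Sum>s=1..S. 1 / real (N s) *
     (\<Sum>i=1..N s. \<Sum>j=1..N s. (b s i j)\<^sup>2 * of_bool (\<bar>b s i j\<bar> > \<epsilon>)))"

text \<open>The bounds of the strata are added. The shares \<open>v s\<close> of the variance sum to
  1 and the shares \<open>l s\<close> of the Lindeberg sum to \<open>L\<close>, so neither the
  number nor the sizes of the strata enter. The constant is \<open>24 = 6 * 4\<close>.\<close>

lemma strat_stein_bound:
  fixes u \<epsilon> :: real
  assumes N: "\<And>s. s \<in> {1..S} \<Longrightarrow> N s \<ge> 2"
    and cols: "\<And>s j. s \<in> {1..S} \<Longrightarrow> j \<in> {1..N s} \<Longrightarrow> (\<Sum>i=1..N s. b s i j) = 0"
    and rows: "\<And>s i. s \<in> {1..S} \<Longrightarrow> i \<in> {1..N s} \<Longrightarrow> (\<Sum>j=1..N s. b s i j) = 0"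
    and var: "(\<Sum>s=1..S. 1 / (real (N s) - 1) * (\<Sum>i=1..N s. \<Sum>j=1..N s. (b s i j)\<^sup>2)) = 1"
    and eps: "\<epsilon> > 0"
  defines "P \<equiv> strat_perms S N" and "T \<equiv> strat_sum S N b" and "L \<equiv> strat_large S N b \<epsilon>"
  shows "cmod ((\<Sum>p\<in>P. complex_of_real (T p) * cis (u * T p)) - \<i> * u * (\<Sum>p\<in>P. cis (u * T p)))
    \<le> \<bar>u\<bar> * card P * (24 * \<bar>u\<bar> * \<epsilon> + 64 * (L / \<epsilon>\<^sup>2) + 10 * L)"
proof -
  define v where "v s = (\<Sum>i=1..N s. \<Sum>j=1..N s. (b s i j)\<^sup>2) / (real (N s) - 1)" for s
  define l where "l s = (\<Sum>i=1..N s. \<Sum>j=1..N s. (b s i j)\<^sup>2 * of_bool (\<bar>b s i j\<bar> > \<epsilon>)) / real (N s)" for s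
  define W where "W s p = (\<Sum>i=1..N s. b s i (p s i))" for s and p :: "nat \<Rightarrow> nat \<Rightarrow> nat"
  let ?c = "4 * \<bar>u\<bar> * \<epsilon>" and ?\<eta> = "L / \<epsilon>\<^sup>2" and ?E = "\<Sum>p\<in>P. cis (u * T p)"
  have v: "(\<Sum>s=1..S. v s) = 1"
    using var by (simp add: v_def)
  have l: "(\<Sum>s=1..S. l s) = L"
    by (simp add: l_def L_def strat_large_def)
  have l_nonneg: "l s \<ge> 0" for s
    unfolding l_def by (intro divide_nonneg_nonneg sum_nonneg mult_nonneg_nonneg) auto
  have stratum: "cmod ((\<Sum>p\<in>P. complex_of_real (W s p) * cis (u * T p)) - \<i> * u * complex_of_real (v s) * ?E)
      \<le> \<bar>u\<bar> * card P * ((6 * ?c + 64 * ?\<eta>) * v s + 10 * l s)" if s: "s \<in> {1..S}" for s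
  proof -
    interpret swap_model P "{1..N s}" "\<lambda>p. p s" "strat_swap s" "b s" T
      unfolding P_def T_def using s N cols rows by (intro swap_model_strat) auto
    have n: "real (N s) \<ge> 2" using N[OF s] by simp
    have "l s \<le> L"
      unfolding l[symmetric] using s by (intro member_le_sum l_nonneg) auto
    \<comment> \<open>The large squares of the whole stratum bound those of any single row or
      column. Estimating \<open>l s\<close> by \<open>L\<close> gives one proportion
      \<open>L / \<epsilon>\<^sup>2\<close> that serves as \<open>\<eta>\<close> in every
      stratum.\<close>
    then have total: "(\<Sum>i=1..N s. \<Sum>j=1..N s. (b s i j)\<^sup>2 * B \<epsilon> i j) \<le> N s * L"
      using n by (simp add: l_def B_def field_simps)
    \<comment> \<open>Markov's inequality in pointwise form: summed over a row or column, it bounds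
      the number of large entries by their squares divided by
      \<open>\<epsilon>\<^sup>2\<close>.\<close>
    have le: "B \<epsilon> i j \<le> (b s i j)\<^sup>2 * B \<epsilon> i j / \<epsilon>\<^sup>2" for i j
    proof (cases "\<bar>b s i j\<bar> > \<epsilon>")
      case True
      then have "\<epsilon>\<^sup>2 \<le> (b s i j)\<^sup>2"
        using eps abs_le_square_iff[of \<epsilon> "b s i j"] by simp
      then show ?thesis
        using eps by (simp add: B_def True)
    qed (simp add: B_def)
    have count: "(\<Sum>j=1..N s. h j) \<le> N s * ?\<eta>"
      if h: "\<And>j. h j \<le> H j / \<epsilon>\<^sup>2" and H: "(\<Sum>j=1..N s. H j) \<le> N s * L" for h H :: "nat \<Rightarrow> real"
    proof -
      have "(\<Sum>j=1..N s. h j) \<le> (\<Sum>j=1..N s. H j) / \<epsilon>\<^sup>2"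
        unfolding sum_divide_distrib by (intro sum_mono h)
      also have "\<dots> \<le> N s * L / \<epsilon>\<^sup>2"
        using H by (intro divide_right_mono) auto
      finally show ?thesis by simp
    qed
    interpret swap_model_lindeberg P "{1..N s}" "\<lambda>p. p s" "strat_swap s" "b s" T u \<epsilon> ?\<eta> ?c
    proof
      show "0 < \<epsilon>" "?c = ?c" by (simp_all add: eps)
      show "(\<Sum>j=1..N s. B \<epsilon> i j) \<le> real (card {1..N s}) * ?\<eta>" if i: "i \<in> {1..N s}" for i
      proof -
        have "(\<Sum>j=1..N s. (b s i j)\<^sup>2 * B \<epsilon> i j) \<le> (\<Sum>i=1..N s. \<Sum>j=1..N s. (b s i j)\<^sup>2 * B \<epsilon> i j)"
          using i by (intro member_le_sum) (auto intro!: sum_nonneg mult_nonneg_nonneg B_nonneg)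
        then show ?thesis
          using count[of "B \<epsilon> i" "\<lambda>j. (b s i j)\<^sup>2 * B \<epsilon> i j", OF le] total by simp
      qed
      show "(\<Sum>i=1..N s. B \<epsilon> i j) \<le> real (card {1..N s}) * ?\<eta>" if j: "j \<in> {1..N s}" for j
      proof -
        have "(\<Sum>i=1..N s. (b s i j)\<^sup>2 * B \<epsilon> i j) \<le> (\<Sum>i=1..N s. \<Sum>j=1..N s. (b s i j)\<^sup>2 * B \<epsilon> i j)"
          using j by (intro sum_mono member_le_sum) (auto intro!: mult_nonneg_nonneg B_nonneg)
        then show ?thesis
          using count[of "\<lambda>i. B \<epsilon> i j" "\<lambda>i. (b s i j)\<^sup>2 * B \<epsilon> i j", OF le] total by simp
      qed
    qed
    have "v s = S2 / (real (card {1..N s}) - 1)" "l s = L2 / real (card {1..N s})"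
      by (simp_all add: v_def l_def S2_def L2_def B_def del: One_nat_def)
    then show ?thesis
      using stein_bound by (simp only: W_def e_def)
  qed
  have T_W: "T p = (\<Sum>s=1..S. W s p)" for p
    by (simp add: T_def strat_sum_def W_def)
  define f where "f p = cis (u * T p)" for p
  have "(\<Sum>p\<in>P. complex_of_real (T p) * f p) = (\<Sum>p\<in>P. \<Sum>s=1..S. complex_of_real (W s p) * f p)"
    by (intro sum.cong refl) (simp add: T_W sum_distrib_right)
  also have "\<dots> = (\<Sum>s=1..S. \<Sum>p\<in>P. complex_of_real (W s p) * f p)"
    by (rule sum.swap)
  finally have W: "(\<Sum>p\<in>P. complex_of_real (T p) * f p) = (\<Sum>s=1..S. \<Sum>p\<in>P. complex_of_real (W s p) * f p)" .
  \<comment> \<open>The coefficient 1 is expanded into the variance shares so that the whole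
    difference splits by strata.\<close>
  have "\<i> * u * (\<Sum>p\<in>P. f p) = \<i> * u * complex_of_real (\<Sum>s=1..S. v s) * (\<Sum>p\<in>P. f p)"
    by (simp only: v of_real_1 mult_1_right)
  also have "\<dots> = (\<Sum>s=1..S. \<i> * u * complex_of_real (v s) * (\<Sum>p\<in>P. f p))"
    by (simp only: of_real_sum sum_distrib_left[of _ _ "{1..S}"] sum_distrib_right[of _ "{1..S}"])
  finally have "(\<Sum>p\<in>P. complex_of_real (T p) * f p) - \<i> * u * (\<Sum>p\<in>P. f p) =
      (\<Sum>s=1..S. (\<Sum>p\<in>P. complex_of_real (W s p) * f p) - \<i> * u * complex_of_real (v s) * (\<Sum>p\<in>P. f p))"
    unfolding W sum_subtractf by (rule arg_cong)
  also have "cmod \<dots> \<le> (\<Sum>s=1..S. \<bar>u\<bar> * card P * ((6 * ?c + 64 * ?\<eta>) * v s + 10 * l s))"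
    unfolding f_def by (intro sum_norm_le stratum)
  also have "\<dots> = \<bar>u\<bar> * card P * ((6 * ?c + 64 * ?\<eta>) * (\<Sum>s=1..S. v s) + 10 * (\<Sum>s=1..S. l s))"
    by (simp only: sum_distrib_left[symmetric] sum.distrib)
  finally show ?thesis
    unfolding v l f_def by (simp add: algebra_simps)
qed

section \<open>Weak convergence for deterministic arrays\<close>

lemma char_pmf_of_set:
  fixes T :: "'a \<Rightarrow> real"
  assumes "finite P" "P \<noteq> {}"
  shows "char (distr (measure_pmf (pmf_of_set P)) borel T) u = (\<Sum>p\<in>P. cis (u * T p)) / card P"
proof -
  have "char (distr (measure_pmf (pmf_of_set P)) borel T) u = (CLINT p|measure_pmf (pmf_of_set P). cis (u * T p))"
    by (simp add: char_def integral_distr cis_conv_exp)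
  also have "\<dots> = (\<Sum>p\<in>P. pmf (pmf_of_set P) p *\<^sub>R cis (u * T p))"
    using assms by (intro integral_measure_pmf) auto
  finally show ?thesis
    using assms by (simp add: scaleR_conv_of_real sum_divide_distrib)
qed

lemma isCont_cdf_std_normal: "isCont (cdf std_normal_distribution) t"
proof -
  interpret real_distribution std_normal_distribution
    by (rule real_dist_normal_dist)
  have "emeasure std_normal_distribution {t} = 0"
    by (subst emeasure_density) (auto simp: nn_integral_indicator_singleton)
  then show ?thesis
    by (simp add: isCont_cdf measure_def)
qed

text \<open>Gathers the conditions that hold at almost every sample point for fixed
  \<open>n\<close>, as needed by the deterministic results.\<close>

definition strat_regular :: "nat \<Rightarrow> (nat \<Rightarrow> nat) \<Rightarrow> (nat \<Rightarrow> nat \<Rightarrow> nat \<Rightarrow> real) \<Rightarrow> bool" where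
  "strat_regular S N a \<longleftrightarrow>
     (\<forall>s\<in>{1..S}. N s \<ge> 2) \<and>
     (\<forall>s\<in>{1..S}. (\<forall>j\<in>{1..N s}. (\<Sum>i=1..N s. a s i j) = 0) \<and> (\<forall>i\<in>{1..N s}. (\<Sum>j=1..N s. a s i j) = 0)) \<and>
     (\<exists>s\<in>{1..S}. \<exists>i\<in>{1..N s}. \<exists>j\<in>{1..N s}. a s i j \<noteq> 0)"

lemma strat_sigma_pos:
  assumes "strat_regular S N a"
  shows "strat_sigma S N a > 0"
proof -
  from assms obtain s i j where s: "s \<in> {1..S}" and i: "i \<in> {1..N s}" and j: "j \<in> {1..N s}"
    and nz: "a s i j \<noteq> 0"
    by (auto simp: strat_regular_def)
  have N: "real (N s) \<ge> 2" if "s \<in> {1..S}" for s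
    using assms that by (auto simp: strat_regular_def)
  have "(\<Sum>j=1..N s. (a s i j)\<^sup>2) > 0"
    using nz j by (intro sum_pos2[of _ j]) auto
  then have "(\<Sum>i=1..N s. \<Sum>j=1..N s. (a s i j)\<^sup>2) > 0"
    using i by (intro sum_pos2[of _ i "\<lambda>i. \<Sum>j=1..N s. (a s i j)\<^sup>2"]) (auto intro!: sum_nonneg)
  then have v: "1 / (real (N s) - 1) * (\<Sum>i=1..N s. \<Sum>j=1..N s. (a s i j)\<^sup>2) > 0"
    using N[OF s] by (intro mult_pos_pos) auto
  have "(\<Sum>s=1..S. 1 / (real (N s) - 1) * (\<Sum>i=1..N s. \<Sum>j=1..N s. (a s i j)\<^sup>2)) > 0"
  proof (rule sum_pos2[OF _ s])
    show "0 \<le> 1 / (real (N s) - 1) * (\<Sum>i=1..N s. \<Sum>j=1..N s. (a s i j)\<^sup>2)" if "s \<in> {1..S}" for s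
      using N[OF that] by (intro mult_nonneg_nonneg sum_nonneg) auto
  qed (use v in simp_all)
  then show ?thesis
    by (simp add: strat_sigma_def)
qed

text \<open>Dividing the array by \<open>\<sigma>\<close> turns \<open>strat_stat\<close> into
  \<open>strat_sum\<close> of an array with variance 1. The defect bound increases with
  \<open>\<bar>v\<bar>\<close>, so its value at \<open>u\<close> is a valid \<open>\<delta>\<close>
  for \<open>char_fun_near_gaussian\<close>.\<close>

lemma strat_char_bound:
  fixes u \<epsilon> :: real
  assumes reg: "strat_regular S N a" and eps: "\<epsilon> > 0"
  defines "P \<equiv> strat_perms S N" and "L \<equiv> strat_lindeberg S N a \<epsilon>"
  shows "cmod ((\<Sum>p\<in>P. cis (u * strat_stat S N a p)) / card P - complex_of_real (exp (- (u\<^sup>2) / 2)))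
    \<le> \<bar>u\<bar> * (\<bar>u\<bar> * (24 * \<bar>u\<bar> * \<epsilon> + 64 * (L / \<epsilon>\<^sup>2) + 10 * L))"
proof -
  define \<sigma> where "\<sigma> = strat_sigma S N a"
  have sigma: "\<sigma> > 0"
    using strat_sigma_pos[OF reg] by (simp add: \<sigma>_def)
  have N: "real (N s) \<ge> 2" if "s \<in> {1..S}" for s
    using reg that by (auto simp: strat_regular_def)
  have sigma2: "\<sigma>\<^sup>2 = (\<Sum>s=1..S. 1 / (real (N s) - 1) * (\<Sum>i=1..N s. \<Sum>j=1..N s. (a s i j)\<^sup>2))"
    unfolding \<sigma>_def strat_sigma_def
    by (rule real_sqrt_pow2, intro sum_nonneg mult_nonneg_nonneg)
       (use N in \<open>fastforce intro!: divide_nonneg_nonneg\<close>, auto)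
  define b where "b s i j = inverse \<sigma> * a s i j" for s i j
  have var: "(\<Sum>s=1..S. 1 / (real (N s) - 1) * (\<Sum>i=1..N s. \<Sum>j=1..N s. (b s i j)\<^sup>2)) = 1"
  proof -
    have "(\<Sum>s=1..S. 1 / (real (N s) - 1) * (\<Sum>i=1..N s. \<Sum>j=1..N s. (b s i j)\<^sup>2)) = (inverse \<sigma>)\<^sup>2 * \<sigma>\<^sup>2"
      unfolding sigma2 by (simp add: b_def power_mult_distrib sum_distrib_left mult_ac)
    then show ?thesis
      using sigma by (simp add: power_mult_distrib[symmetric])
  qed
  have stat: "strat_stat S N a p = strat_sum S N b p" for p
    by (simp add: strat_stat_def strat_sum_def b_def \<sigma>_def sum_distrib_left)
  have abs_b: "\<bar>b s i j\<bar> = inverse \<sigma> * \<bar>a s i j\<bar>" for s i j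
    using sigma by (simp add: b_def abs_mult)
  have L: "L = strat_large S N b \<epsilon>"
    unfolding L_def strat_lindeberg_def strat_large_def \<sigma>_def[symmetric] abs_b sum_distrib_left
    by (intro sum.cong refl) (simp add: b_def power_mult_distrib divide_inverse power_inverse mult_ac)
  have "L \<ge> 0"
    unfolding L strat_large_def by (intro sum_nonneg mult_nonneg_nonneg) auto
  have "cmod ((\<Sum>p\<in>P. complex_of_real (strat_sum S N b p) * cis (v * strat_sum S N b p)) -
      \<i> * v * (\<Sum>p\<in>P. cis (v * strat_sum S N b p)))
    \<le> card P * (\<bar>u\<bar> * (24 * \<bar>u\<bar> * \<epsilon> + 64 * (L / \<epsilon>\<^sup>2) + 10 * L))" if v: "\<bar>v\<bar> \<le> \<bar>u\<bar>" for v
  proof -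
    have "cmod ((\<Sum>p\<in>P. complex_of_real (strat_sum S N b p) * cis (v * strat_sum S N b p)) -
      \<i> * v * (\<Sum>p\<in>P. cis (v * strat_sum S N b p)))
      \<le> \<bar>v\<bar> * card P * (24 * \<bar>v\<bar> * \<epsilon> + 64 * (L / \<epsilon>\<^sup>2) + 10 * L)"
      unfolding P_def L using reg var eps
      by (intro strat_stein_bound) (auto simp: strat_regular_def b_def simp flip: sum_distrib_left)
    also have "\<dots> = card P * (\<bar>v\<bar> * (24 * \<bar>v\<bar> * \<epsilon> + 64 * (L / \<epsilon>\<^sup>2) + 10 * L))"
      by (simp add: mult_ac)
    also have "\<dots> \<le> card P * (\<bar>u\<bar> * (24 * \<bar>u\<bar> * \<epsilon> + 64 * (L / \<epsilon>\<^sup>2) + 10 * L))"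
      using v eps \<open>L \<ge> 0\<close> by (intro mult_left_mono mult_mono add_mono) auto
    finally show ?thesis .
  qed
  then show ?thesis
    unfolding stat
    by (intro char_fun_near_gaussian) (auto simp: P_def finite_strat_perms strat_perms_nonempty)
qed

text \<open>In \<open>strat_char_bound\<close> first \<open>n\<close> tends to infinity with
  \<open>\<epsilon>\<close> fixed; the remaining term is proportional to \<open>\<epsilon>\<close>.
  Levy's theorem gives weak convergence, which holds at every \<open>t\<close> because the normal
  distribution function is continuous.\<close>

theorem stratified_combinatorial_clt:
  fixes S :: "nat \<Rightarrow> nat" and N :: "nat \<Rightarrow> nat \<Rightarrow> nat" and a :: "nat \<Rightarrow> nat \<Rightarrow> nat \<Rightarrow> nat \<Rightarrow> real"
  assumes reg: "\<And>n. strat_regular (S n) (N n) (a n)"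
    and lindeberg: "\<And>\<epsilon>. \<epsilon> > 0 \<Longrightarrow> (\<lambda>n. strat_lindeberg (S n) (N n) (a n) \<epsilon>) \<longlonglongrightarrow> 0"
  shows "(\<lambda>n. measure_pmf.prob (pmf_of_set (strat_perms (S n) (N n)))
      {p. strat_stat (S n) (N n) (a n) p \<le> t}) \<longlonglongrightarrow> cdf std_normal_distribution t"
proof -
  define M where "M n = distr (measure_pmf (pmf_of_set (strat_perms (S n) (N n)))) borel
    (strat_stat (S n) (N n) (a n))" for n
  have "weak_conv_m M std_normal_distribution"
  proof (rule levy_continuity)
    show "real_distribution (M n)" for n
      unfolding M_def by (intro prob_space.real_distribution_distr measure_pmf.prob_space_axioms) simp
    show "real_distribution std_normal_distribution"
      by (rule real_dist_normal_dist)
    show "(\<lambda>n. char (M n) u) \<longlonglongrightarrow> char std_normal_distribution u" for u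
    proof (rule LIMSEQ_I)
      fix r :: real assume r: "r > 0"
      \<comment> \<open>Chosen so that the limit \<open>24 * \<bar>u\<bar> ^ 3 * \<epsilon>\<close>
        of the bound is below \<open>r / 2\<close>; the summand 1 keeps the denominator positive at
        \<open>u = 0\<close>.\<close>
      define \<epsilon> where "\<epsilon> = r / (48 * (1 + \<bar>u\<bar> ^ 3))"
      have pos: "1 + \<bar>u\<bar> ^ 3 > 0" by (simp add: add_pos_nonneg)
      have eps: "\<epsilon> > 0" using r pos by (simp add: \<epsilon>_def)
      have "24 * \<bar>u\<bar> ^ 3 * \<epsilon> < r / 2"
        using r pos by (simp add: \<epsilon>_def divide_simps)
      moreover have lim: "(\<lambda>n. \<bar>u\<bar> * (\<bar>u\<bar> * (24 * \<bar>u\<bar> * \<epsilon> + 64 * (strat_lindeberg (S n) (N n) (a n) \<epsilon> / \<epsilon>\<^sup>2) +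
          10 * strat_lindeberg (S n) (N n) (a n) \<epsilon>))) \<longlonglongrightarrow> \<bar>u\<bar> * (\<bar>u\<bar> * (24 * \<bar>u\<bar> * \<epsilon> + 64 * (0 / \<epsilon>\<^sup>2) + 10 * 0))"
        using eps by (intro tendsto_intros lindeberg) auto
      moreover have "\<bar>u\<bar> * (\<bar>u\<bar> * (24 * \<bar>u\<bar> * \<epsilon> + 64 * (0 / \<epsilon>\<^sup>2) + 10 * 0)) = 24 * \<bar>u\<bar> ^ 3 * \<epsilon>"
        by (simp add: power3_eq_cube)
      ultimately have "\<forall>\<^sub>F n in sequentially. \<bar>u\<bar> * (\<bar>u\<bar> * (24 * \<bar>u\<bar> * \<epsilon> +
          64 * (strat_lindeberg (S n) (N n) (a n) \<epsilon> / \<epsilon>\<^sup>2) + 10 * strat_lindeberg (S n) (N n) (a n) \<epsilon>)) < r"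
        using r by (intro order_tendstoD(2)[OF lim]) linarith
      then have "\<forall>\<^sub>F n in sequentially. cmod (char (M n) u - char std_normal_distribution u) < r"
      proof eventually_elim
        case (elim n)
        then show ?case
          using strat_char_bound[OF reg[of n] eps, of u]
          by (simp add: M_def char_pmf_of_set finite_strat_perms strat_perms_nonempty
              char_std_normal_distribution)
      qed
      then show "\<exists>no. \<forall>n\<ge>no. cmod (char (M n) u - char std_normal_distribution u) < r"
        by (simp add: eventually_sequentially)
    qed
  qed
  then have "(\<lambda>n. cdf (M n) t) \<longlonglongrightarrow> cdf std_normal_distribution t"
    by (simp add: weak_conv_m_def weak_conv_def isCont_cdf_std_normal)
  moreover have "cdf (M n) t = measure_pmf.prob (pmf_of_set (strat_perms (S n) (N n)))
      {p. strat_stat (S n) (N n) (a n) p \<le> t}" for n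
    by (simp add: cdf_def M_def measure_distr vimage_def)
  ultimately show ?thesis
    by simp
qed

section \<open>Measurability with respect to the generated sigma-algebra\<close>

lemma borel_measurable_sum_upto:
  fixes g :: "nat \<Rightarrow> 'w \<Rightarrow> real"
  assumes K: "K \<in> F \<rightarrow>\<^sub>M count_space UNIV" and g: "\<And>s. g s \<in> borel_measurable F"
  shows "(\<lambda>\<omega>. \<Sum>s=1..K \<omega>. g s \<omega>) \<in> borel_measurable F"
  by (rule measurable_compose_countable[where f = "\<lambda>k \<omega>. \<Sum>s=1..k. g s \<omega>", OF _ K])
     (intro borel_measurable_sum g)

lemma borel_measurable_strat_stat:
  assumes S: "S \<in> F \<rightarrow>\<^sub>M count_space UNIV"
    and N: "\<And>s. (\<lambda>\<omega>. N \<omega> s) \<in> F \<rightarrow>\<^sub>M count_space UNIV"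
    and a: "\<And>s i j. (\<lambda>\<omega>. a \<omega> s i j) \<in> borel_measurable F"
    and q: "\<And>s i. (\<lambda>\<omega>. q \<omega> s i) \<in> F \<rightarrow>\<^sub>M count_space UNIV"
  shows "(\<lambda>\<omega>. strat_stat (S \<omega>) (N \<omega>) (a \<omega>) (q \<omega>)) \<in> borel_measurable F"
proof -
  have [measurable]: "(\<lambda>\<omega>. \<Sum>s=1..S \<omega>. 1 / (real (N \<omega> s) - 1) *
      (\<Sum>i=1..N \<omega> s. \<Sum>j=1..N \<omega> s. (a \<omega> s i j)\<^sup>2)) \<in> borel_measurable F"
    by (intro borel_measurable_sum_upto S N borel_measurable_times borel_measurable_divide
        borel_measurable_diff borel_measurable_const borel_measurable_power a)
       (use N in measurable)
  have "(\<lambda>\<omega>. a \<omega> s i (q \<omega> s i)) \<in> borel_measurable F" for s i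
    by (rule measurable_compose_countable[where f = "\<lambda>j \<omega>. a \<omega> s i j", OF a q])
  then have [measurable]: "(\<lambda>\<omega>. \<Sum>s=1..S \<omega>. \<Sum>i=1..N \<omega> s. a \<omega> s i (q \<omega> s i)) \<in> borel_measurable F"
    by (intro borel_measurable_sum_upto S N)
  show ?thesis
    unfolding strat_stat_def strat_sigma_def by measurable
qed

lemma strat_perms_restrict:
  "strat_perms S (\<lambda>s. if s \<in> {1..S} then N s else 0) = strat_perms S N"
  by (auto simp: strat_perms_def)

text \<open>\<open>strat_data\<close> sets irrelevant entries to 0, so the cut-off array is what can
  be recovered from \<open>strat_algebra\<close>. A stratified permutation maps
  \<open>{1..N s}\<close> to itself and hence reads relevant entries only.\<close>

lemma strat_stat_restrict:
  assumes p: "p \<in> strat_perms S N"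
  shows "strat_stat S (\<lambda>s. if s \<in> {1..S} then N s else 0)
     (\<lambda>s i j. if s \<in> {1..S} \<and> i \<in> {1..N s} \<and> j \<in> {1..N s} then a s i j else 0) p = strat_stat S N a p"
proof -
  have "p s i \<in> {1..N s}" if "s \<in> {1..S}" "i \<in> {1..N s}" for s i
    using p that permutes_in_image[of "p s" "{1..N s}" i] by (auto simp: strat_perms_def)
  then show ?thesis
    unfolding strat_stat_def strat_sigma_def
    by (intro arg_cong2[where f = "(*)"] arg_cong[where f = inverse] arg_cong[where f = sqrt] sum.cong refl)
       auto
qed

text \<open>For fixed \<open>p\<close> both events are determined by the array and the
  stratification. Their indicators can therefore be taken out of conditional expectations in
  \<open>cond_prob_strat_stat\<close>.\<close>

lemma sets_strat_algebra:
  fixes S :: "'w \<Rightarrow> nat"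
  shows "{\<omega> \<in> space M. p \<in> strat_perms (S \<omega>) (N \<omega>)} \<in> sets (strat_algebra M S N a)"
    and "{\<omega> \<in> space M. p \<in> strat_perms (S \<omega>) (N \<omega>) \<and> strat_stat (S \<omega>) (N \<omega>) (a \<omega>) p \<le> t}
      \<in> sets (strat_algebra M S N a)"
proof -
  let ?F = "strat_algebra M S N a"
  define N' where "N' \<omega> s = (if s \<in> {1..S \<omega>} then N \<omega> s else 0)" for \<omega> s
  define a' where "a' \<omega> s i j = (if s \<in> {1..S \<omega>} \<and> i \<in> {1..N \<omega> s} \<and> j \<in> {1..N \<omega> s} then a \<omega> s i j else 0)"
    for \<omega> s i j
  have sp: "space ?F = space M"
    by (simp add: strat_algebra_def)
  have [measurable]: "(\<lambda>\<omega>. strat_data (S \<omega>) (N \<omega>) (a \<omega>)) \<in>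
      ?F \<rightarrow>\<^sub>M (count_space UNIV \<Otimes>\<^sub>M (\<Pi>\<^sub>M s\<in>UNIV. count_space UNIV) \<Otimes>\<^sub>M (\<Pi>\<^sub>M k\<in>UNIV. borel))"
    unfolding strat_algebra_def
    by (rule measurable_vimage_algebra1) (auto simp: space_pair_measure space_PiM)
  have "(\<lambda>\<omega>. fst (strat_data (S \<omega>) (N \<omega>) (a \<omega>))) \<in> ?F \<rightarrow>\<^sub>M count_space UNIV"
    by measurable
  then have S [measurable]: "S \<in> ?F \<rightarrow>\<^sub>M count_space UNIV"
    by (simp add: strat_data_def)
  have "(\<lambda>\<omega>. fst (snd (strat_data (S \<omega>) (N \<omega>) (a \<omega>))) s) \<in> ?F \<rightarrow>\<^sub>M count_space UNIV" for s
    by measurable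
  then have N [measurable]: "(\<lambda>\<omega>. N' \<omega> s) \<in> ?F \<rightarrow>\<^sub>M count_space UNIV" for s
    by (simp add: strat_data_def N'_def)
  have "(\<lambda>\<omega>. snd (snd (strat_data (S \<omega>) (N \<omega>) (a \<omega>))) (s, i, j)) \<in> borel_measurable ?F" for s i j
    by measurable
  then have a: "(\<lambda>\<omega>. a' \<omega> s i j) \<in> borel_measurable ?F" for s i j
    by (simp add: strat_data_def a'_def)
  have stat [measurable]: "(\<lambda>\<omega>. strat_stat (S \<omega>) (N' \<omega>) (a' \<omega>) p) \<in> borel_measurable ?F"
    by (rule borel_measurable_strat_stat[OF S N a]) simp
  have "Measurable.pred ?F (\<lambda>\<omega>. p \<in> strat_perms k (N' \<omega>))" for k
    unfolding strat_perms_def mem_Collect_eq by measurable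
  from measurable_compose_countable[OF this S]
  have perms [measurable]: "Measurable.pred ?F (\<lambda>\<omega>. p \<in> strat_perms (S \<omega>) (N' \<omega>))" .
  have perms_eq: "strat_perms (S \<omega>) (N' \<omega>) = strat_perms (S \<omega>) (N \<omega>)" for \<omega>
    unfolding N'_def by (rule strat_perms_restrict)
  have stat_eq: "strat_stat (S \<omega>) (N' \<omega>) (a' \<omega>) p = strat_stat (S \<omega>) (N \<omega>) (a \<omega>) p"
    if "p \<in> strat_perms (S \<omega>) (N \<omega>)" for \<omega>
    unfolding N'_def a'_def by (rule strat_stat_restrict[OF that])
  have "{\<omega> \<in> space ?F. p \<in> strat_perms (S \<omega>) (N' \<omega>)} \<in> sets ?F"
    by measurable
  then show "{\<omega> \<in> space M. p \<in> strat_perms (S \<omega>) (N \<omega>)} \<in> sets ?F"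
    by (simp add: sp perms_eq)
  have "{\<omega> \<in> space ?F. p \<in> strat_perms (S \<omega>) (N' \<omega>) \<and> strat_stat (S \<omega>) (N' \<omega>) (a' \<omega>) p \<le> t} \<in> sets ?F"
    by measurable
  then show "{\<omega> \<in> space M. p \<in> strat_perms (S \<omega>) (N \<omega>) \<and> strat_stat (S \<omega>) (N \<omega>) (a \<omega>) p \<le> t} \<in> sets ?F"
    by (simp add: sp perms_eq stat_eq cong: conj_cong)
qed

section \<open>The conditional distribution of the statistic\<close>

lemma strat_perms_subset:
  assumes N: "\<forall>s\<in>{1..S}. N s \<ge> 2" and sum: "(\<Sum>s=1..S. N s) = n"
  shows "strat_perms S N \<subseteq> strat_perms n (\<lambda>_. n)"
proof
  fix p assume p: "p \<in> strat_perms S N"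
  have "S = (\<Sum>s=1..S. 1)" by simp
  also have "\<dots> \<le> (\<Sum>s=1..S. N s)"
    using N by (intro sum_mono) force
  finally have S: "S \<le> n" using sum by simp
  have Nn: "N s \<le> n" if "s \<in> {1..S}" for s
    unfolding sum[symmetric] using that by (intro member_le_sum) auto
  have "p s permutes {1..n}" for s
  proof (cases "s \<in> {1..S}")
    case True
    then have "p s permutes {1..N s}" using p by (simp add: strat_perms_def)
    then show ?thesis
      by (rule permutes_subset) (use Nn[OF True] in auto)
  next
    case False
    then have "p s = id" using p by (simp add: strat_perms_def)
    then show ?thesis by (simp add: permutes_id)
  qed
  then show "p \<in> strat_perms n (\<lambda>_. n)"
    using p S by (auto simp: strat_perms_def)
qed

text \<open>The uniformity assumption speaks of one \<open>p\<close> at a time. Within the finite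
  set \<open>C\<close>, which depends on \<open>n\<close> only, the null sets can be united, and the
  event becomes a finite sum of indicators of \<open>\<pi> \<omega> = p\<close> with coefficients
  measurable for \<open>F\<close>.\<close>

lemma cond_prob_strat_stat:
  fixes M :: "'w measure"
  assumes "prob_space M"
    and S [measurable]: "S \<in> M \<rightarrow>\<^sub>M count_space UNIV"
    and N [measurable]: "\<And>s. (\<lambda>\<omega>. N \<omega> s) \<in> M \<rightarrow>\<^sub>M count_space UNIV"
    and a [measurable]: "\<And>s i j. (\<lambda>\<omega>. a \<omega> s i j) \<in> borel_measurable M"
    and pi [measurable]: "\<And>s i. (\<lambda>\<omega>. \<pi> \<omega> s i) \<in> M \<rightarrow>\<^sub>M count_space UNIV"
    and N_ge: "AE \<omega> in M. \<forall>s\<in>{1..S \<omega>}. N \<omega> s \<ge> 2"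
    and N_sum: "AE \<omega> in M. (\<Sum>s=1..S \<omega>. N \<omega> s) = n"
    and uniform: "\<And>p. AE \<omega> in M. cond_prob_alg M (strat_algebra M S N a) (\<lambda>\<omega>'. \<pi> \<omega>' = p) \<omega> =
      pmf (pmf_of_set (strat_perms (S \<omega>) (N \<omega>))) p"
  shows "AE \<omega> in M. cond_prob_alg M (strat_algebra M S N a)
      (\<lambda>\<omega>'. strat_stat (S \<omega>') (N \<omega>') (a \<omega>') (\<pi> \<omega>') \<le> t) \<omega> =
    measure_pmf.prob (pmf_of_set (strat_perms (S \<omega>) (N \<omega>))) {p. strat_stat (S \<omega>) (N \<omega>) (a \<omega>) p \<le> t}"
proof -
  interpret prob_space M by fact
  define F where "F = strat_algebra M S N a"
  have sub: "subalgebra M F"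
    unfolding F_def by (rule subalgebra_strat_algebra) measurable
  interpret finite_measure_subalgebra M F
    by unfold_locales (rule sub)
  define C where "C = strat_perms n (\<lambda>_. n)"
  define Q where "Q \<omega> = strat_perms (S \<omega>) (N \<omega>)" for \<omega>
  define st where "st \<omega> p = strat_stat (S \<omega>) (N \<omega>) (a \<omega>) p" for \<omega> p
  define Z where "Z p = (indicator {\<omega> \<in> space M. \<pi> \<omega> = p} :: 'w \<Rightarrow> real)" for p
  define G where "G p = (indicator {\<omega> \<in> space M. p \<in> Q \<omega>} :: 'w \<Rightarrow> real)" for p
  define H where "H p = (indicator {\<omega> \<in> space M. p \<in> Q \<omega> \<and> st \<omega> p \<le> t} :: 'w \<Rightarrow> real)" for p
  have finC: "finite C" and finQ: "finite (Q \<omega>)" and Q_ne: "Q \<omega> \<noteq> {}" for \<omega>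
    by (simp_all add: C_def Q_def finite_strat_perms strat_perms_nonempty)
  have cardQ: "real (card (Q \<omega>)) > 0" for \<omega>
    using finQ[of \<omega>] Q_ne[of \<omega>] by (simp add: card_gt_0_iff)
  have pmfQ: "pmf (pmf_of_set (Q \<omega>)) p = of_bool (p \<in> Q \<omega>) / card (Q \<omega>)" for \<omega> p
    using finQ[of \<omega>] Q_ne[of \<omega>] by simp
  have GF: "G p \<in> borel_measurable F" and HF: "H p \<in> borel_measurable F" for p
    unfolding G_def H_def Q_def st_def F_def
    by (intro borel_measurable_indicator sets_strat_algebra)+
  have [measurable]: "G p \<in> borel_measurable M" "H p \<in> borel_measurable M" for p
    by (intro measurable_from_subalg[OF sub] GF HF)+
  have "{\<omega> \<in> space M. \<pi> \<omega> = p} \<in> sets M" for p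
  proof -
    have "{\<omega> \<in> space M. \<forall>s i. \<pi> \<omega> s i = p s i} \<in> sets M" by measurable
    then show ?thesis by (simp add: fun_eq_iff)
  qed
  then have [measurable]: "Z p \<in> borel_measurable M" for p
    unfolding Z_def by (rule borel_measurable_indicator)
  have intGZ: "integrable M (\<lambda>\<omega>. G p \<omega> * Z p \<omega>)" and intHZ: "integrable M (\<lambda>\<omega>. H p \<omega> * Z p \<omega>)" for p
  proof -
    have "norm (G p \<omega> * Z p \<omega>) \<le> 1" "norm (H p \<omega> * Z p \<omega>) \<le> 1" for \<omega>
      by (auto simp: G_def H_def Z_def indicator_def)
    then show "integrable M (\<lambda>\<omega>. G p \<omega> * Z p \<omega>)" "integrable M (\<lambda>\<omega>. H p \<omega> * Z p \<omega>)"
      by (auto intro!: integrable_const_bound[where B = 1])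
  qed
  have rce_Z: "AE \<omega> in M. real_cond_exp M F (Z p) \<omega> = pmf (pmf_of_set (Q \<omega>)) p" for p
    using uniform[of p] by (simp add: cond_prob_alg_def F_def Z_def Q_def)
  have QC: "AE \<omega> in M. Q \<omega> \<subseteq> C"
    using N_ge N_sum by eventually_elim (unfold Q_def C_def, rule strat_perms_subset)
  have sum_le: "(\<Sum>p\<in>C. G p \<omega> * Z p \<omega>) = of_bool (\<pi> \<omega> \<in> C \<and> \<pi> \<omega> \<in> Q \<omega>)" if "\<omega> \<in> space M" for \<omega>
  proof -
    have "(\<Sum>p\<in>C. G p \<omega> * Z p \<omega>) = (\<Sum>p\<in>C. if p = \<pi> \<omega> then of_bool (p \<in> Q \<omega>) else 0)"
      using that by (intro sum.cong) (auto simp: G_def Z_def)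
    then show ?thesis using finC by simp
  qed
  \<comment> \<open>The integral is the probability that \<open>\<pi> \<omega>\<close> lies in both
    \<open>C\<close> and \<open>Q \<omega>\<close>. As \<open>G p\<close> is measurable for
    \<open>F\<close>, \<open>Z p\<close> may be replaced by its conditional expectation, which is
    \<open>1 / card (Q \<omega>)\<close> on \<open>Q \<omega>\<close>.\<close>
  have total: "(\<integral>\<omega>. (\<Sum>p\<in>C. G p \<omega> * Z p \<omega>) \<partial>M) = 1"
  proof -
    have "(\<integral>\<omega>. (\<Sum>p\<in>C. G p \<omega> * Z p \<omega>) \<partial>M) = (\<Sum>p\<in>C. \<integral>\<omega>. G p \<omega> * Z p \<omega> \<partial>M)"
      by (intro Bochner_Integration.integral_sum intGZ)
    also have "\<dots> = (\<Sum>p\<in>C. \<integral>\<omega>. G p \<omega> * real_cond_exp M F (Z p) \<omega> \<partial>M)"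
      by (intro sum.cong refl real_cond_exp_intg(2)[symmetric] intGZ GF) measurable
    also have "\<dots> = (\<integral>\<omega>. (\<Sum>p\<in>C. G p \<omega> * real_cond_exp M F (Z p) \<omega>) \<partial>M)"
      by (intro Bochner_Integration.integral_sum[symmetric] real_cond_exp_intg(1) intGZ GF) measurable
    also have "\<dots> = (\<integral>\<omega>. 1 \<partial>M)"
    proof (rule integral_cong_AE)
      have "AE \<omega> in M. \<forall>p\<in>C. real_cond_exp M F (Z p) \<omega> = pmf (pmf_of_set (Q \<omega>)) p"
        using rce_Z finC by (intro AE_finite_allI) auto
      with QC AE_space show "AE \<omega> in M. (\<Sum>p\<in>C. G p \<omega> * real_cond_exp M F (Z p) \<omega>) = 1"
      proof (eventually_elim, goal_cases)
        case (1 \<omega>)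
        then have "(\<Sum>p\<in>C. G p \<omega> * real_cond_exp M F (Z p) \<omega>) =
            (\<Sum>p\<in>C. if p \<in> Q \<omega> then 1 / card (Q \<omega>) else 0)"
          by (intro sum.cong refl) (simp add: G_def pmfQ)
        also have "\<dots> = (\<Sum>p\<in>C \<inter> Q \<omega>. 1 / card (Q \<omega>))"
          by (rule sum.inter_restrict[OF finC, symmetric])
        also have "C \<inter> Q \<omega> = Q \<omega>"
          using 1 by auto
        finally show ?case
          using cardQ[of \<omega>] by simp
      qed
    qed measurable
    finally show ?thesis by (simp add: prob_space)
  qed
  \<comment> \<open>That \<open>\<pi>\<close> is almost surely a stratified permutation is a
    consequence: an indicator with integral 1 equals 1 almost everywhere.\<close>
  have in_Q: "AE \<omega> in M. \<pi> \<omega> \<in> C \<and> \<pi> \<omega> \<in> Q \<omega>"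
  proof -
    let ?f = "\<lambda>\<omega>. 1 - (\<Sum>p\<in>C. G p \<omega> * Z p \<omega>)"
    have int: "integrable M (\<lambda>\<omega>. \<Sum>p\<in>C. G p \<omega> * Z p \<omega>)"
      by (intro Bochner_Integration.integrable_sum intGZ)
    then have "(\<integral>\<omega>. ?f \<omega> \<partial>M) = 0"
      by (subst Bochner_Integration.integral_diff) (auto simp: total prob_space)
    moreover have "integrable M ?f"
      using int by auto
    moreover have "AE \<omega> in M. 0 \<le> ?f \<omega>"
      using AE_space by eventually_elim (simp add: sum_le)
    ultimately have "AE \<omega> in M. ?f \<omega> = 0"
      using integral_nonneg_eq_0_iff_AE by blast
    with AE_space show ?thesis
      by eventually_elim (auto simp: sum_le)
  qed
  let ?A = "indicator {\<omega> \<in> space M. st \<omega> (\<pi> \<omega>) \<le> t} :: 'w \<Rightarrow> real"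
  have "{\<omega> \<in> space M. st \<omega> (\<pi> \<omega>) \<le> t} \<in> sets M"
  proof -
    have [measurable]: "(\<lambda>\<omega>. st \<omega> (\<pi> \<omega>)) \<in> borel_measurable M"
      unfolding st_def by (rule borel_measurable_strat_stat[OF S N a pi])
    show ?thesis by measurable
  qed
  then have [measurable]: "?A \<in> borel_measurable M"
    by (rule borel_measurable_indicator)
  \<comment> \<open>Almost surely \<open>\<pi> \<omega>\<close> is in \<open>C\<close> and in
    \<open>Q \<omega>\<close>, and then only the summand with \<open>p = \<pi> \<omega>\<close> can
    be nonzero.\<close>
  have "AE \<omega> in M. ?A \<omega> = (\<Sum>p\<in>C. H p \<omega> * Z p \<omega>)"
    using in_Q AE_space
  proof eventually_elim
    case (elim \<omega>)
    then have "(\<Sum>p\<in>C. H p \<omega> * Z p \<omega>) = (\<Sum>p\<in>C. if p = \<pi> \<omega> then of_bool (st \<omega> p \<le> t) else 0)"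
      by (intro sum.cong) (auto simp: H_def Z_def)
    then show ?case
      using elim finC by simp
  qed
  then have cong: "AE \<omega> in M. real_cond_exp M F ?A \<omega> = real_cond_exp M F (\<lambda>\<omega>. \<Sum>p\<in>C. H p \<omega> * Z p \<omega>) \<omega>"
    by (rule real_cond_exp_cong) measurable
  have "AE \<omega> in M. real_cond_exp M F (\<lambda>\<omega>. \<Sum>p\<in>C. H p \<omega> * Z p \<omega>) \<omega> =
      (\<Sum>p\<in>C. real_cond_exp M F (\<lambda>\<omega>. H p \<omega> * Z p \<omega>) \<omega>)"
    by (intro real_cond_exp_sum intHZ)
  moreover have "AE \<omega> in M. \<forall>p\<in>C. real_cond_exp M F (\<lambda>\<omega>. H p \<omega> * Z p \<omega>) \<omega> =
      H p \<omega> * real_cond_exp M F (Z p) \<omega>"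
    using finC by (intro AE_finite_allI real_cond_exp_mult HF intHZ) auto
  moreover have "AE \<omega> in M. \<forall>p\<in>C. real_cond_exp M F (Z p) \<omega> = pmf (pmf_of_set (Q \<omega>)) p"
    using rce_Z finC by (intro AE_finite_allI) auto
  ultimately have "AE \<omega> in M. real_cond_exp M F ?A \<omega> =
      measure_pmf.prob (pmf_of_set (Q \<omega>)) {p. st \<omega> p \<le> t}"
    using cong QC AE_space
  proof eventually_elim
    case (elim \<omega>)
    then have "real_cond_exp M F ?A \<omega> = (\<Sum>p\<in>C. if p \<in> Q \<omega> \<inter> {p. st \<omega> p \<le> t} then 1 / card (Q \<omega>) else 0)"
      by (auto simp: H_def pmfQ intro!: sum.cong)
    also have "\<dots> = (\<Sum>p\<in>C \<inter> (Q \<omega> \<inter> {p. st \<omega> p \<le> t}). 1 / card (Q \<omega>))"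
      by (rule sum.inter_restrict[OF finC, symmetric])
    also have "C \<inter> (Q \<omega> \<inter> {p. st \<omega> p \<le> t}) = Q \<omega> \<inter> {p. st \<omega> p \<le> t}"
      using elim by auto
    finally show ?case
      using finQ[of \<omega>] Q_ne[of \<omega>] by (simp add: measure_pmf_of_set)
  qed
  then show ?thesis
    by (simp add: cond_prob_alg_def F_def Q_def st_def)
qed

section \<open>The almost sure limit\<close>

lemma strat_lindeberg_nonneg: "strat_lindeberg S N a \<epsilon> \<ge> 0"
  unfolding strat_lindeberg_def by (intro mult_nonneg_nonneg sum_nonneg) auto

lemma strat_lindeberg_antimono: "\<delta> \<le> \<epsilon> \<Longrightarrow> strat_lindeberg S N a \<epsilon> \<le> strat_lindeberg S N a \<delta>"
  unfolding strat_lindeberg_def by (intro mult_left_mono sum_mono) auto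

theorem theorem2p1:
  fixes M :: "'w measure"
    and S :: "nat \<Rightarrow> 'w \<Rightarrow> nat"
    and N :: "nat \<Rightarrow> 'w \<Rightarrow> nat \<Rightarrow> nat"
    and a :: "nat \<Rightarrow> 'w \<Rightarrow> nat \<Rightarrow> nat \<Rightarrow> nat \<Rightarrow> real"
    and \<pi> :: "nat \<Rightarrow> 'w \<Rightarrow> nat \<Rightarrow> nat \<Rightarrow> nat"
  assumes "prob_space M"
    and S_rv: "\<And>n. n \<ge> 2 \<Longrightarrow> S n \<in> M \<rightarrow>\<^sub>M count_space UNIV"
    and N_rv: "\<And>n s. n \<ge> 2 \<Longrightarrow> (\<lambda>\<omega>. N n \<omega> s) \<in> M \<rightarrow>\<^sub>M count_space UNIV"
    and a_rv: "\<And>n s i j. n \<ge> 2 \<Longrightarrow> (\<lambda>\<omega>. a n \<omega> s i j) \<in> borel_measurable M"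
    and pi_rv: "\<And>n s i. n \<ge> 2 \<Longrightarrow> (\<lambda>\<omega>. \<pi> n \<omega> s i) \<in> M \<rightarrow>\<^sub>M count_space UNIV"
    and S_ge: "\<And>n. n \<ge> 2 \<Longrightarrow> AE \<omega> in M. S n \<omega> \<ge> 1"
    and N_ge: "\<And>n. n \<ge> 2 \<Longrightarrow> AE \<omega> in M. \<forall>s\<in>{1..S n \<omega>}. N n \<omega> s \<ge> 2"
    and N_sum: "\<And>n. n \<ge> 2 \<Longrightarrow> AE \<omega> in M. (\<Sum>s=1..S n \<omega>. N n \<omega> s) = n"
    and pi_uniform: "\<And>n p. n \<ge> 2 \<Longrightarrow>
      AE \<omega> in M. cond_prob_alg M (strat_algebra M (S n) (N n) (a n)) (\<lambda>\<omega>'. \<pi> n \<omega>' = p) \<omega> =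
        pmf (pmf_of_set (strat_perms (S n \<omega>) (N n \<omega>))) p"
    and centered: "\<And>n. n \<ge> 2 \<Longrightarrow>
      AE \<omega> in M. \<forall>s\<in>{1..S n \<omega>}.
        (\<forall>j\<in>{1..N n \<omega> s}. (\<Sum>i=1..N n \<omega> s. a n \<omega> s i j) = 0) \<and>
        (\<forall>i\<in>{1..N n \<omega> s}. (\<Sum>j=1..N n \<omega> s. a n \<omega> s i j) = 0)"
    and lindeberg: "\<And>\<epsilon>. \<epsilon> > 0 \<Longrightarrow>
      AE \<omega> in M. (\<lambda>n. strat_lindeberg (S n \<omega>) (N n \<omega>) (a n \<omega>) \<epsilon>) \<longlonglongrightarrow> 0"
    and nonzero: "\<And>n. n \<ge> 2 \<Longrightarrow>
      AE \<omega> in M. \<exists>s\<in>{1..S n \<omega>}. \<exists>i\<in>{1..N n \<omega> s}. \<exists>j\<in>{1..N n \<omega> s}. a n \<omega> s i j \<noteq> 0"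
  shows "\<forall>t::real. AE \<omega> in M.
    (\<lambda>n. cond_prob_alg M (strat_algebra M (S n) (N n) (a n))
           (\<lambda>\<omega>'. strat_stat (S n \<omega>') (N n \<omega>') (a n \<omega>') (\<pi> n \<omega>') \<le> t) \<omega>)
      \<longlonglongrightarrow> cdf std_normal_distribution t"
proof
  fix t :: real
  \<comment> \<open>There are countably many \<open>n\<close>, so one null set serves them all. The
    range starts at 2 because a stratum has at least two elements.\<close>
  have "AE \<omega> in M. \<forall>n\<in>{2..}. strat_regular (S n \<omega>) (N n \<omega>) (a n \<omega>)"
  proof (subst AE_ball_countable)
    show "\<forall>n\<in>{2..}. AE \<omega> in M. strat_regular (S n \<omega>) (N n \<omega>) (a n \<omega>)"
    proof
      fix n :: nat assume "n \<in> {2..}"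
      then have n: "n \<ge> 2" by simp
      show "AE \<omega> in M. strat_regular (S n \<omega>) (N n \<omega>) (a n \<omega>)"
        using N_ge[OF n] centered[OF n] nonzero[OF n]
        by eventually_elim (simp add: strat_regular_def)
    qed
  qed simp
  moreover have "AE \<omega> in M. \<forall>n\<in>{2..}. cond_prob_alg M (strat_algebra M (S n) (N n) (a n))
      (\<lambda>\<omega>'. strat_stat (S n \<omega>') (N n \<omega>') (a n \<omega>') (\<pi> n \<omega>') \<le> t) \<omega> =
      measure_pmf.prob (pmf_of_set (strat_perms (S n \<omega>) (N n \<omega>)))
        {p. strat_stat (S n \<omega>) (N n \<omega>) (a n \<omega>) p \<le> t}"
    using assms by (subst AE_ball_countable) (auto intro!: cond_prob_strat_stat)
  \<comment> \<open>The null set of the Lindeberg condition may depend on \<open>\<epsilon>\<close>.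
    The countably many values \<open>1 / real (Suc k)\<close> suffice, since
    \<open>strat_lindeberg\<close> is nonnegative and does not increase with
    \<open>\<epsilon>\<close>.\<close>
  moreover have "AE \<omega> in M. \<forall>k. (\<lambda>n. strat_lindeberg (S n \<omega>) (N n \<omega>) (a n \<omega>) (1 / real (Suc k))) \<longlonglongrightarrow> 0"
    by (subst AE_all_countable) (auto intro!: lindeberg)
  ultimately show "AE \<omega> in M.
    (\<lambda>n. cond_prob_alg M (strat_algebra M (S n) (N n) (a n))
           (\<lambda>\<omega>'. strat_stat (S n \<omega>') (N n \<omega>') (a n \<omega>') (\<pi> n \<omega>') \<le> t) \<omega>)
      \<longlonglongrightarrow> cdf std_normal_distribution t"
  proof eventually_elim
    case (elim \<omega>)
    \<comment> \<open>The deterministic theorem requires regularity at every index, so all sequences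
      are shifted by 2, which does not affect the limit.\<close>
    have reg: "strat_regular (S (n + 2) \<omega>) (N (n + 2) \<omega>) (a (n + 2) \<omega>)" for n
      using elim by simp
    have "(\<lambda>n. strat_lindeberg (S (n + 2) \<omega>) (N (n + 2) \<omega>) (a (n + 2) \<omega>) \<epsilon>) \<longlonglongrightarrow> 0" if "\<epsilon> > 0" for \<epsilon>
    proof -
      obtain k where k: "1 / real (Suc k) < \<epsilon>"
        using nat_approx_posE[OF \<open>\<epsilon> > 0\<close>] by blast
      have "(\<lambda>n. strat_lindeberg (S (n + 2) \<omega>) (N (n + 2) \<omega>) (a (n + 2) \<omega>) (1 / real (Suc k))) \<longlonglongrightarrow> 0"
        using elim LIMSEQ_ignore_initial_segment[of _ 0 2] by blast
      from tendsto_sandwich[OF _ _ tendsto_const this] show ?thesis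
        using k by (simp add: strat_lindeberg_nonneg strat_lindeberg_antimono)
    qed
    with reg have "(\<lambda>n. measure_pmf.prob (pmf_of_set (strat_perms (S (n + 2) \<omega>) (N (n + 2) \<omega>)))
        {p. strat_stat (S (n + 2) \<omega>) (N (n + 2) \<omega>) (a (n + 2) \<omega>) p \<le> t}) \<longlonglongrightarrow> cdf std_normal_distribution t"
      by (rule stratified_combinatorial_clt)
    then show ?case
      using elim by - (rule LIMSEQ_offset[where k = 2], simp)
  qed
qed

end
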